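(* Let $K$ be a local field, $L/K$ an unramified quadratic extension, and let $r\in \mathbf{N}$. The map $$B_{0}(r)\to \mathcal{I}^{0,r}\colon [(g,x)]\mapsto [(p_{r}(g),x)]^{0,r}$$ (where points of $B_0(r)$ are represented by pairs $(g,x)$ with $g\in P_0$ and $x\in[-\omega(\pi_L^{r}),\omega(\pi_L^{r})]$) is a well-defined bijection, equivariant with respect to the homomorphism $p_{r}\colon P_{0}\to P_{0}^{0,r}$.
   Context: $K$ is a non-archimedean local field, $L/K$ a quadratic unramified extension, $x\mapsto\bar x$ its non-trivial Galois automorphism, $\mathcal{O}_L,\mathfrak{m}_L,\pi_L$ the ring of integers, maximal ideal and a uniformiser of $L$, $\omega$ the (real-valued) valuation on $L$. $\mathrm{SU}_3^{L/K}(K)=\{g\in\mathrm{SL}_3(L)\mid{}^S\bar gg=\mathrm{Id}\}$, where ${}^Sg$ is the transpose along the anti-diagonal: $({}^Sg)_{ij}=g_{4-j,4-i}$. For matrices, $\omega(g)\ge m$ means $\omega(g_{ij})\ge m_{ij}$ for all $i,j$. Put $V_x=\begin{pmatrix} 0 & -\frac{x}{2} & -x \\ \frac{x}{2} & 0 & -\frac{x}{2} \\ x & \frac{x}{2} & 0 \end{pmatrix}$. Bruhat--Tits tree. For $x\in\mathbf{R}$ let $P_x=\{g\in\mathrm{SU}_3^{L/K}(K)\mid\omega(g)\ge V_x\}$. Let $T=\{\mathrm{diag}(x,x^{-1}\bar x,\bar x^{-1})\mid x\in L^\times\}$, $M=\{\begin{pmatrix} 0 & 0 & x \\ 0 & -x^{-1}\bar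 x & 0 \\ \bar x^{-1} & 0 & 0 \end{pmatrix}\mid x\in L^\times\}$, $N=T\sqcup M$, and $\nu\colon N\to\mathrm{Aff}(\mathbf{R})$ the homomorphism sending the element of $M$ with parameter $x$ to the reflection through $-\omega(x)$ and the element of $T$ with parameter $x$ to the translation by $-2\omega(x)$. On $\mathrm{SU}_3^{L/K}(K)\times\mathbf{R}$ put $(g,x)\sim(h,y)$ iff there is $n\in N$ with $\nu(n)(x)=y$ and $g^{-1}hn\in P_x$. $\mathcal{I}$ is the quotient, with classes $[(g,x)]$; $\mathrm{SU}_3^{L/K}(K)$ acts by left multiplication on the first component. $\mathcal{I}$ carries an invariant metric restricting on each apartment $\{[(g,x)]\mid x\in\mathbf{R}\}$ to the metric of $\mathbf{R}$, scaled so that $0$ and $\omega(\pi_L)$ are at distance $1$. $B_0(r)$ is the closed ball of radius $r$ around $[(\mathrm{Id},0)]$; equivalently $B_0(r)=\{[(g,x)]\mid g\in P_0,\ x\in[-\omega(\pi_L^r),\omega(\pi_L^r)]\}$. Local version. The valuation and conjugation induce maps $\omega$ (with $\omega(0)=\infty$) and $x\mapsto\bar x$ on $\mathcal{O}_L/\mathfrak{m}_L^r$. For $x\in[-\omega(\pi_L^r),\omega(\pi_L^r)]$ let $P_x^{0,r}=\{g\in\mathrm{SL}_3(\mathcal{O}_L/\mathfrak{m}_L^r)\mid{}^S\bar gg=\mathrm{Id},\ \omega(g)\ge V_x\}$. Let $H^{0,r}$ (resp. $M^{0,r}$) be the set of matrices in $\mathrm{SL}_3(\mathcal{O}_L/\mathfrak{m}_L^r)$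 of the form $\mathrm{diag}(x,x^{-1}\bar x,\bar x^{-1})$ (resp. $\begin{pmatrix} 0 & 0 & x \\ 0 & -x^{-1}\bar x & 0 \\ \bar x^{-1} & 0 & 0 \end{pmatrix}$) with $\omega(x)=0$, $N^{0,r}=H^{0,r}\sqcup M^{0,r}$, and let $\nu$ send $H^{0,r}$ to the identity of $\mathbf{R}$ and each element of $M^{0,r}$ to the reflection through $0$. On $P_0^{0,r}\times[-\omega(\pi_L^r),\omega(\pi_L^r)]$ put $(g,x)\sim_{0,r}(h,y)$ iff there is $n\in N^{0,r}$ with $\nu(n)(x)=y$ and $g^{-1}hn\in P_x^{0,r}$. $\mathcal{I}^{0,r}$ is the quotient, with classes $[(g,x)]^{0,r}$, on which $P_0^{0,r}$ acts by left multiplication on the first component. $p_r\colon P_0\to P_0^{0,r}$ is induced by reduction of coefficients $\mathcal{O}_L\to\mathcal{O}_L/\mathfrak{m}_L^r$. *)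

theory Defs
  imports
    "HOL-Analysis.Analysis"
    "HOL-Algebra.QuotRing"
    "HOL-Algebra.Ideal_Product"
begin

section \<open>Local fields and unramified quadratic extensions\<close>

definition valuation :: "('a::field \<Rightarrow> ereal) \<Rightarrow> bool" where
  "valuation \<omega> \<longleftrightarrow>
     (\<forall>x. \<omega> x \<noteq> - \<infinity>) \<and>
     (\<forall>x. \<omega> x = \<infinity> \<longleftrightarrow> x = 0) \<and>
     (\<forall>x y. \<omega> (x * y) = \<omega> x + \<omega> y) \<and>
     (\<forall>x y. min (\<omega> x) (\<omega> y) \<le> \<omega> (x + y))"

definition val_ring :: "('a::field \<Rightarrow> ereal) \<Rightarrow> 'a ring" where
  "val_ring \<omega> = \<lparr>carrier = {x. 0 \<le> \<omega> x}, monoid.mult = (*), one = 1, zero = 0, add = (+)\<rparr>"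

definition max_ideal :: "('a::field \<Rightarrow> ereal) \<Rightarrow> 'a set" where
  "max_ideal \<omega> = {x. 0 < \<omega> x}"

definition uniformiser :: "('a::field \<Rightarrow> ereal) \<Rightarrow> 'a \<Rightarrow> bool" where
  "uniformiser \<omega> \<pi> \<longleftrightarrow> PIdl\<^bsub>val_ring \<omega>\<^esub> \<pi> = max_ideal \<omega>"

definition discrete_val :: "('a::field \<Rightarrow> ereal) \<Rightarrow> bool" where
  "discrete_val \<omega> \<longleftrightarrow>
     (\<exists>\<pi>. \<pi> \<noteq> 0 \<and> 0 < \<omega> \<pi> \<and> (\<forall>x. x \<noteq> 0 \<longrightarrow> (\<exists>n::int. \<omega> x = \<omega> (\<pi> powi n))))"

definition complete_val :: "('a::field \<Rightarrow> ereal) \<Rightarrow> bool" where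
  "complete_val \<omega> \<longleftrightarrow>
     (\<forall>X::nat \<Rightarrow> 'a.
        (\<forall>c::real. \<exists>N. \<forall>m\<ge>N. \<forall>n\<ge>N. ereal c \<le> \<omega> (X m - X n)) \<longrightarrow>
        (\<exists>l. \<forall>c::real. \<exists>N. \<forall>n\<ge>N. ereal c \<le> \<omega> (X n - l)))"

definition nonarch_local_field :: "('a::field \<Rightarrow> ereal) \<Rightarrow> bool" where
  "nonarch_local_field \<omega> \<longleftrightarrow>
     valuation \<omega> \<and> discrete_val \<omega> \<and> complete_val \<omega> \<and>
     finite (carrier (val_ring \<omega> Quot max_ideal \<omega>))"

definition field_embedding :: "('k::field \<Rightarrow> 'l::field) \<Rightarrow> bool" where
  "field_embedding \<iota> \<longleftrightarrow>
     \<iota> 1 = 1 \<and> (\<forall>a b. \<iota> (a + b) = \<iota> a + \<iota> b) \<and> (\<forall>a b. \<iota> (a * b) = \<iota> a * \<iota> b)"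

definition quadratic_ext :: "('k::field \<Rightarrow> 'l::field) \<Rightarrow> bool" where
  "quadratic_ext \<iota> \<longleftrightarrow>
     field_embedding \<iota> \<and> vector_space.dim (\<lambda>a x. \<iota> a * x) (UNIV :: 'l set) = 2"

text \<open>
  Ramification index one, the valuation of \<open>K\<close> being the restriction \<open>\<omega> \<circ> \<iota>\<close> of that of \<open>L\<close>.
  The residue field of a local field is finite, hence perfect, so separability of the residue
  extension is automatic.
\<close>
definition unramified :: "('k::field \<Rightarrow> 'l::field) \<Rightarrow> ('l \<Rightarrow> ereal) \<Rightarrow> bool" where
  "unramified \<iota> \<omega> \<longleftrightarrow> (\<omega> \<circ> \<iota>) ` (- {0}) = \<omega> ` (- {0})"

definition nontrivial_automorphism :: "('k::field \<Rightarrow> 'l::field) \<Rightarrow> ('l \<Rightarrow> 'l) \<Rightarrow> bool" where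
  "nontrivial_automorphism \<iota> \<sigma> \<longleftrightarrow>
     field_embedding \<sigma> \<and> bij \<sigma> \<and> (\<forall>a. \<sigma> (\<iota> a) = \<iota> a) \<and> \<sigma> \<noteq> id"


section \<open>Three by three matrices\<close>

text \<open>
  Indices live in the type \<open>3\<close>, whose arithmetic is modulo 3 (so \<open>3 = 0\<close> and \<open>4 = 1\<close>):
  \<open>4 - i\<close> exchanges 1 and 3 and fixes 2, and \<open>i + j = 4\<close> describes the anti-diagonal.
  The zero entry \<open>z\<close> is an argument so that the same functions serve for matrices over a
  residue ring, whose elements are cosets.
\<close>

type_synonym 'a mat33 = "('a^3)^3"

definition antitranspose :: "'a mat33 \<Rightarrow> 'a mat33" where
  "antitranspose g = (\<chi> i j. g $ (4 - j) $ (4 - i))"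

definition map_mat :: "('a \<Rightarrow> 'b) \<Rightarrow> 'a mat33 \<Rightarrow> 'b mat33" where
  "map_mat f g = (\<chi> i j. f (g $ i $ j))"

definition diag3 :: "'a \<Rightarrow> 'a \<Rightarrow> 'a \<Rightarrow> 'a \<Rightarrow> 'a mat33" where
  "diag3 z a b c =
     (\<chi> i j. if i = j then (if i = 1 then a else if i = 2 then b else c) else z)"

definition antidiag3 :: "'a \<Rightarrow> 'a \<Rightarrow> 'a \<Rightarrow> 'a \<Rightarrow> 'a mat33" where
  "antidiag3 z a b c =
     (\<chi> i j. if i + j = 4 then (if i = 1 then a else if i = 2 then b else c) else z)"

definition V_mat :: "real \<Rightarrow> real mat33" where
  "V_mat x = vector [vector [0, - x / 2, - x],
                 vector [x / 2, 0, - x / 2],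
                 vector [x, x / 2, 0]]"

definition mat_val_ge :: "('a \<Rightarrow> ereal) \<Rightarrow> 'a mat33 \<Rightarrow> real mat33 \<Rightarrow> bool" where
  "mat_val_ge \<omega> g m \<longleftrightarrow> (\<forall>i j. ereal (m $ i $ j) \<le> \<omega> (g $ i $ j))"


section \<open>The Bruhat--Tits tree\<close>

definition SU3 :: "('l::field \<Rightarrow> 'l) \<Rightarrow> ('l mat33) set" where
  "SU3 \<sigma> = {g. det g = 1 \<and> antitranspose (map_mat \<sigma> g) ** g = mat 1}"

definition bt_P :: "('l::field \<Rightarrow> ereal) \<Rightarrow> ('l \<Rightarrow> 'l) \<Rightarrow> real \<Rightarrow> ('l mat33) set" where
  "bt_P \<omega> \<sigma> x = {g \<in> SU3 \<sigma>. mat_val_ge \<omega> g (V_mat x)}"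

definition bt_T :: "('l::field \<Rightarrow> 'l) \<Rightarrow> ('l mat33) set" where
  "bt_T \<sigma> = {diag3 0 x (inverse x * \<sigma> x) (inverse (\<sigma> x)) | x. x \<noteq> 0}"

definition bt_M :: "('l::field \<Rightarrow> 'l) \<Rightarrow> ('l mat33) set" where
  "bt_M \<sigma> = {antidiag3 0 x (- (inverse x * \<sigma> x)) (inverse (\<sigma> x)) | x. x \<noteq> 0}"

definition bt_N :: "('l::field \<Rightarrow> 'l) \<Rightarrow> ('l mat33) set" where
  "bt_N \<sigma> = bt_T \<sigma> \<union> bt_M \<sigma>"

text \<open>
  The parameter \<open>x\<close> of an element of \<open>T\<close> (resp. \<open>M\<close>) is its entry at position (1,1) (resp. (1,3)).
\<close>
definition bt_\<nu> :: "('l::field \<Rightarrow> ereal) \<Rightarrow> ('l \<Rightarrow> 'l) \<Rightarrow> 'l mat33 \<Rightarrow> real \<Rightarrow> real" where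
  "bt_\<nu> \<omega> \<sigma> n t =
     (if n \<in> bt_T \<sigma> then t - 2 * real_of_ereal (\<omega> (n $ 1 $ 1))
      else 2 * (- real_of_ereal (\<omega> (n $ 1 $ 3))) - t)"

definition bt_rel ::
    "('l::field \<Rightarrow> ereal) \<Rightarrow> ('l \<Rightarrow> 'l) \<Rightarrow> (('l mat33 \<times> real) \<times> ('l mat33 \<times> real)) set" where
  "bt_rel \<omega> \<sigma> = {((g, x), (h, y)). g \<in> SU3 \<sigma> \<and> h \<in> SU3 \<sigma> \<and>
     (\<exists>n \<in> bt_N \<sigma>. bt_\<nu> \<omega> \<sigma> n x = y \<and> matrix_inv g ** h ** n \<in> bt_P \<omega> \<sigma> x)}"

definition bt_tree :: "('l::field \<Rightarrow> ereal) \<Rightarrow> ('l \<Rightarrow> 'l) \<Rightarrow> ('l mat33 \<times> real) set set" where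
  "bt_tree \<omega> \<sigma> = (SU3 \<sigma> \<times> UNIV) // bt_rel \<omega> \<sigma>"

definition bt_class ::
    "('l::field \<Rightarrow> ereal) \<Rightarrow> ('l \<Rightarrow> 'l) \<Rightarrow> 'l mat33 \<Rightarrow> real \<Rightarrow> ('l mat33 \<times> real) set" where
  "bt_class \<omega> \<sigma> g x = bt_rel \<omega> \<sigma> `` {(g, x)}"

definition bt_act :: "'l::field mat33 \<Rightarrow> ('l mat33 \<times> real) set \<Rightarrow> ('l mat33 \<times> real) set" where
  "bt_act h p = (\<lambda>(g, x). (h ** g, x)) ` p"

definition bt_metric ::
    "('l::field \<Rightarrow> ereal) \<Rightarrow> ('l \<Rightarrow> 'l) \<Rightarrow> 'l \<Rightarrow>
     (('l mat33 \<times> real) set \<Rightarrow> ('l mat33 \<times> real) set \<Rightarrow> real) \<Rightarrow> bool" where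
  "bt_metric \<omega> \<sigma> \<pi> d \<longleftrightarrow>
     Metric_space (bt_tree \<omega> \<sigma>) d \<and>
     (\<forall>h \<in> SU3 \<sigma>. \<forall>p \<in> bt_tree \<omega> \<sigma>. \<forall>q \<in> bt_tree \<omega> \<sigma>. d (bt_act h p) (bt_act h q) = d p q) \<and>
     (\<forall>g \<in> SU3 \<sigma>. \<forall>x y. d (bt_class \<omega> \<sigma> g x) (bt_class \<omega> \<sigma> g y) =
                           \<bar>x - y\<bar> / real_of_ereal (\<omega> \<pi>))"

definition bt_ball ::
    "('l::field \<Rightarrow> ereal) \<Rightarrow> ('l \<Rightarrow> 'l) \<Rightarrow>
     (('l mat33 \<times> real) set \<Rightarrow> ('l mat33 \<times> real) set \<Rightarrow> real) \<Rightarrow> nat \<Rightarrow> ('l mat33 \<times> real) set set" where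
  "bt_ball \<omega> \<sigma> d r = Metric_space.mcball (bt_tree \<omega> \<sigma>) d (bt_class \<omega> \<sigma> (mat 1) 0) (real r)"

definition segment :: "('l::field \<Rightarrow> ereal) \<Rightarrow> 'l \<Rightarrow> nat \<Rightarrow> real set" where
  "segment \<omega> \<pi> r = {- real_of_ereal (\<omega> (\<pi> ^ r)) .. real_of_ereal (\<omega> (\<pi> ^ r))}"


section \<open>Matrices over a ring given by a carrier\<close>

text \<open>Needed because a residue ring is not a type; \<open>mat_det\<close> is the Leibniz formula.\<close>

definition mat_monoid :: "('a, 'b) ring_scheme \<Rightarrow> ('a mat33) monoid" where
  "mat_monoid R =
     \<lparr>carrier = {g. \<forall>i j. g $ i $ j \<in> carrier R},
      monoid.mult = (\<lambda>g h. \<chi> i j. \<Oplus>\<^bsub>R\<^esub>k\<in>UNIV. g $ i $ k \<otimes>\<^bsub>R\<^esub> h $ k $ j),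
      one = (\<chi> i j. if i = j then \<one>\<^bsub>R\<^esub> else \<zero>\<^bsub>R\<^esub>)\<rparr>"

definition mat_det :: "('a, 'b) ring_scheme \<Rightarrow> 'a mat33 \<Rightarrow> 'a" where
  "mat_det R g =
     (\<Oplus>\<^bsub>R\<^esub>p\<in>{p. p permutes (UNIV :: 3 set)}.
        (if evenperm p then \<one>\<^bsub>R\<^esub> else \<ominus>\<^bsub>R\<^esub> \<one>\<^bsub>R\<^esub>) \<otimes>\<^bsub>R\<^esub> (\<Otimes>\<^bsub>R\<^esub>i\<in>UNIV. g $ i $ p i))"

definition SL3 :: "('a, 'b) ring_scheme \<Rightarrow> ('a mat33) set" where
  "SL3 R = {g \<in> carrier (mat_monoid R). mat_det R g = \<one>\<^bsub>R\<^esub>}"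


section \<open>The local version\<close>

definition max_ideal_pow :: "('l::field \<Rightarrow> ereal) \<Rightarrow> nat \<Rightarrow> 'l set" where
  "max_ideal_pow \<omega> r = max_ideal \<omega> [^]\<^bsub>ideals_set (val_ring \<omega>)\<^esub> r"

definition res_ring :: "('l::field \<Rightarrow> ereal) \<Rightarrow> nat \<Rightarrow> 'l set ring" where
  "res_ring \<omega> r = val_ring \<omega> Quot max_ideal_pow \<omega> r"

text \<open>Elements of a nonzero coset all have the same valuation.\<close>
definition res_val :: "('l::field \<Rightarrow> ereal) \<Rightarrow> nat \<Rightarrow> 'l set \<Rightarrow> ereal" where
  "res_val \<omega> r X = (if X = \<zero>\<^bsub>res_ring \<omega> r\<^esub> then \<infinity> else \<omega> (SOME a. a \<in> X))"

definition res_conj :: "('l::field \<Rightarrow> 'l) \<Rightarrow> 'l set \<Rightarrow> 'l set" where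
  "res_conj \<sigma> X = \<sigma> ` X"

definition reduce :: "('l::field \<Rightarrow> ereal) \<Rightarrow> nat \<Rightarrow> 'l mat33 \<Rightarrow> 'l set mat33" where
  "reduce \<omega> r g = map_mat (\<lambda>a. max_ideal_pow \<omega> r +>\<^bsub>val_ring \<omega>\<^esub> a) g"

definition loc_P ::
    "('l::field \<Rightarrow> ereal) \<Rightarrow> ('l \<Rightarrow> 'l) \<Rightarrow> nat \<Rightarrow> real \<Rightarrow> ('l set mat33) set" where
  "loc_P \<omega> \<sigma> r x =
     (let Mat = mat_monoid (res_ring \<omega> r) in
      {g \<in> SL3 (res_ring \<omega> r).
         antitranspose (map_mat (res_conj \<sigma>) g) \<otimes>\<^bsub>Mat\<^esub> g = \<one>\<^bsub>Mat\<^esub> \<and>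
         mat_val_ge (res_val \<omega> r) g (V_mat x)})"

definition loc_H :: "('l::field \<Rightarrow> ereal) \<Rightarrow> ('l \<Rightarrow> 'l) \<Rightarrow> nat \<Rightarrow> ('l set mat33) set" where
  "loc_H \<omega> \<sigma> r =
     (let R = res_ring \<omega> r in
      {g \<in> SL3 R. \<exists>x \<in> carrier R. res_val \<omega> r x = 0 \<and>
         g = diag3 \<zero>\<^bsub>R\<^esub> x (m_inv R x \<otimes>\<^bsub>R\<^esub> res_conj \<sigma> x) (m_inv R (res_conj \<sigma> x))})"

definition loc_M :: "('l::field \<Rightarrow> ereal) \<Rightarrow> ('l \<Rightarrow> 'l) \<Rightarrow> nat \<Rightarrow> ('l set mat33) set" where
  "loc_M \<omega> \<sigma> r =
     (let R = res_ring \<omega> r in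
      {g \<in> SL3 R. \<exists>x \<in> carrier R. res_val \<omega> r x = 0 \<and>
         g = antidiag3 \<zero>\<^bsub>R\<^esub> x (\<ominus>\<^bsub>R\<^esub> (m_inv R x \<otimes>\<^bsub>R\<^esub> res_conj \<sigma> x)) (m_inv R (res_conj \<sigma> x))})"

definition loc_N :: "('l::field \<Rightarrow> ereal) \<Rightarrow> ('l \<Rightarrow> 'l) \<Rightarrow> nat \<Rightarrow> ('l set mat33) set" where
  "loc_N \<omega> \<sigma> r = loc_H \<omega> \<sigma> r \<union> loc_M \<omega> \<sigma> r"

definition loc_\<nu> ::
    "('l::field \<Rightarrow> ereal) \<Rightarrow> ('l \<Rightarrow> 'l) \<Rightarrow> nat \<Rightarrow> 'l set mat33 \<Rightarrow> real \<Rightarrow> real" where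
  "loc_\<nu> \<omega> \<sigma> r n t = (if n \<in> loc_H \<omega> \<sigma> r then t else - t)"

definition loc_rel ::
    "('l::field \<Rightarrow> ereal) \<Rightarrow> ('l \<Rightarrow> 'l) \<Rightarrow> 'l \<Rightarrow> nat \<Rightarrow>
     (('l set mat33 \<times> real) \<times> ('l set mat33 \<times> real)) set" where
  "loc_rel \<omega> \<sigma> \<pi> r =
     (let Mat = mat_monoid (res_ring \<omega> r) in
      {((g, x), (h, y)).
         g \<in> loc_P \<omega> \<sigma> r 0 \<and> x \<in> segment \<omega> \<pi> r \<and>
         h \<in> loc_P \<omega> \<sigma> r 0 \<and> y \<in> segment \<omega> \<pi> r \<and>
         (\<exists>n \<in> loc_N \<omega> \<sigma> r. loc_\<nu> \<omega> \<sigma> r n x = y \<and>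
            m_inv Mat g \<otimes>\<^bsub>Mat\<^esub> h \<otimes>\<^bsub>Mat\<^esub> n \<in> loc_P \<omega> \<sigma> r x)})"

definition loc_tree ::
    "('l::field \<Rightarrow> ereal) \<Rightarrow> ('l \<Rightarrow> 'l) \<Rightarrow> 'l \<Rightarrow> nat \<Rightarrow> ('l set mat33 \<times> real) set set" where
  "loc_tree \<omega> \<sigma> \<pi> r = (loc_P \<omega> \<sigma> r 0 \<times> segment \<omega> \<pi> r) // loc_rel \<omega> \<sigma> \<pi> r"

definition loc_class ::
    "('l::field \<Rightarrow> ereal) \<Rightarrow> ('l \<Rightarrow> 'l) \<Rightarrow> 'l \<Rightarrow> nat \<Rightarrow>
     'l set mat33 \<Rightarrow> real \<Rightarrow> ('l set mat33 \<times> real) set" where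
  "loc_class \<omega> \<sigma> \<pi> r g x = loc_rel \<omega> \<sigma> \<pi> r `` {(g, x)}"

definition loc_act ::
    "('l::field \<Rightarrow> ereal) \<Rightarrow> nat \<Rightarrow> 'l set mat33 \<Rightarrow>
     ('l set mat33 \<times> real) set \<Rightarrow> ('l set mat33 \<times> real) set" where
  "loc_act \<omega> r h p = (\<lambda>(g, x). (h \<otimes>\<^bsub>mat_monoid (res_ring \<omega> r)\<^esub> g, x)) ` p"

end

theory Submission
  imports Defs
begin

text \<open>
  For \<open>g\<close>, \<open>h\<close> in \<open>P\<^sub>0\<close> the points \<open>[(g, x)]\<close> and \<open>[(h, y)]\<close> of the tree agree iff \<open>y = x\<close> or
  \<open>y = - x\<close> (the invariant metric gives \<open>\<bar>x\<bar> = \<bar>y\<bar>\<close>) and the entries of \<open>g\<^sup>-\<^sup>1 h\<close> satisfy valuation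
  bounds depending on \<open>x\<close> and \<open>y\<close>. For \<open>x\<close>, \<open>y\<close> in the segment these bounds are at most
  \<open>\<omega>(\<pi>\<^sup>r)\<close>, hence visible modulo the \<open>r\<close>-th power of the maximal ideal, so the same condition
  describes equality in the local version.

  That every point of the ball has a representative in \<open>P\<^sub>0\<close>, and that \<open>P\<^sub>0\<close> surjects onto its local
  version, both come from lifting isotropic primitive columns to columns of elements of \<open>P\<^sub>0\<close>, exactly
  or modulo a power of the maximal ideal. The lifting corrects an approximate solution of
  \<open>b + \<sigma> b + a \<sigma> a = 0\<close> by an element of trace one, which exists as the extension is unramified. The
  first statement needs moreover the factorisation of an upper unipotent element as lower unipotent
  times an element of \<open>M\<close> times lower unipotent.
\<close>

section \<open>Valued fields\<close>

text \<open>Neither its existence nor the invariance of \<open>\<omega>\<close> under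
  \<open>\<sigma>\<close> is a hypothesis. Being unramified only says that the value groups agree,
  so both are proved by approximation: if they failed, elements of \<open>L\<close> outside
  \<open>K\<close> would be limits of elements of \<open>K\<close>, against completeness.

  The two equivalence relations quantify over different groups: \<open>N\<close> acts on the line
  also by translations, its local version only by the identity and one reflection. The element of
  \<open>N\<close> is therefore eliminated on both sides before anything is compared.\<close>

lemma valuation_one: assumes "valuation \<omega>" shows "\<omega> 1 = 0"
proof -
  have "\<omega> 1 = \<omega> 1 + \<omega> 1" "\<omega> 1 \<noteq> \<infinity>" "\<omega> 1 \<noteq> -\<infinity>"
    using assms unfolding valuation_def by (metis mult_1, metis zero_neq_one, blast)
  then show ?thesis by (cases "\<omega> 1") auto
qed

lemma valuation_minus: assumes "valuation \<omega>" shows "\<omega> (- x) = \<omega> x"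
proof -
  have "\<omega> (-1) + \<omega> (-1) = 0" "\<omega> (-1) \<noteq> \<infinity>" "\<omega> (-1) \<noteq> -\<infinity>"
    using assms valuation_one[OF assms] unfolding valuation_def
    by (metis mult_minus1 minus_minus, metis neg_equal_0_iff_equal zero_neq_one, blast)
  then have "\<omega> (-1) = 0" by (cases "\<omega> (-1)") (auto simp: zero_ereal_def)
  moreover have "\<omega> (- x) = \<omega> (-1) + \<omega> x"
    using assms unfolding valuation_def by (metis mult_minus1)
  ultimately show ?thesis by simp
qed

locale valued_field =
  fixes \<omega> :: "'l::field \<Rightarrow> ereal"
  assumes val: "valuation \<omega>"
begin

lemma val_mult: "\<omega> (x * y) = \<omega> x + \<omega> y"
  and val_infty [simp]: "\<omega> x = \<infinity> \<longleftrightarrow> x = 0"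
  and val_minf [simp]: "\<omega> x \<noteq> -\<infinity>"
  using val unfolding valuation_def by blast+

lemma val_zero [simp]: "\<omega> 0 = \<infinity>" by simp

lemma val_one [simp]: "\<omega> 1 = 0" by (rule valuation_one[OF val])

lemma val_uminus [simp]: "\<omega> (- x) = \<omega> x" by (rule valuation_minus[OF val])

lemma val_add: "c \<le> \<omega> x \<Longrightarrow> c \<le> \<omega> y \<Longrightarrow> c \<le> \<omega> (x + y)"
  using val unfolding valuation_def by (meson min.boundedI order_trans)

lemma val_diff: "c \<le> \<omega> x \<Longrightarrow> c \<le> \<omega> y \<Longrightarrow> c \<le> \<omega> (x - y)"
  using val_add[of c x "- y"] by simp

lemma val_add_less: "c < \<omega> x \<Longrightarrow> c < \<omega> y \<Longrightarrow> c < \<omega> (x + y)"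
  using val unfolding valuation_def by (metis less_le_trans min_less_iff_conj)

text \<open>The ultrametric principle that makes the valuation constant on a nonzero coset and keeps
  an element close to a unit a unit.\<close>

lemma val_eq_of_diff: assumes "\<omega> a < \<omega> (b - a)" shows "\<omega> b = \<omega> a"
proof (rule antisym)
  show "\<omega> a \<le> \<omega> b" using val_add[of "\<omega> a" a "b - a"] assms by simp
  show "\<omega> b \<le> \<omega> a"
  proof (rule ccontr)
    assume "\<not> \<omega> b \<le> \<omega> a"
    then have "\<omega> a < \<omega> (b + (- (b - a)))" using assms by (intro val_add_less) (auto simp only: val_uminus not_le)
    then show False by simp
  qed
qed

text \<open>Real-valued, so that linear arithmetic applies. At 0 it takes the default value 0, hence
  multiplicativity is stated for nonzero arguments.\<close>

definition v :: "'l \<Rightarrow> real" where "v x = real_of_ereal (\<omega> x)"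

lemma val_eq_v: "x \<noteq> 0 \<Longrightarrow> \<omega> x = ereal (v x)"
  unfolding v_def using val_infty[of x] val_minf[of x] by (cases "\<omega> x") auto

lemma v_mult: "x \<noteq> 0 \<Longrightarrow> y \<noteq> 0 \<Longrightarrow> v (x * y) = v x + v y"
  using val_mult[of x y] by (simp add: val_eq_v)

lemma v_one [simp]: "v 1 = 0" by (simp add: v_def)

lemma v_inverse: "x \<noteq> 0 \<Longrightarrow> v (inverse x) = - v x"
  using v_mult[of x "inverse x"] by simp

lemma v_divide: "x \<noteq> 0 \<Longrightarrow> y \<noteq> 0 \<Longrightarrow> v (x / y) = v x - v y"
  using v_mult[of x "inverse y"] by (simp add: v_inverse divide_inverse)

lemma v_power: "x \<noteq> 0 \<Longrightarrow> v (x ^ n) = n * v x"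
  by (induction n) (auto simp: v_mult algebra_simps)

end

section \<open>Unramified quadratic extensions\<close>

text \<open>Stated for an arbitrary embedding in order to serve both \<iota> and \<sigma>.\<close>

lemma field_embedding_simps:
  fixes \<iota> :: "'k::field \<Rightarrow> 'l::field"
  assumes "field_embedding \<iota>"
  shows "\<iota> 1 = 1" "\<iota> (a + b) = \<iota> a + \<iota> b" "\<iota> (a * b) = \<iota> a * \<iota> b" "\<iota> 0 = 0" "\<iota> (- a) = - \<iota> a"
    "\<iota> (a - b) = \<iota> a - \<iota> b" "\<iota> a = 0 \<longleftrightarrow> a = 0" "\<iota> (inverse a) = inverse (\<iota> a)"
    "\<iota> (a / b) = \<iota> a / \<iota> b" "\<iota> (a ^ n) = \<iota> a ^ n"
proof -
  show one: "\<iota> 1 = 1" and add: "\<iota> (a + b) = \<iota> a + \<iota> b" and mult: "\<iota> (a * b) = \<iota> a * \<iota> b" for a b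
    using assms by (auto simp: field_embedding_def)
  show zero: "\<iota> 0 = 0" using add[of 0 0] by (metis add_0 add_left_imp_eq add.right_neutral)
  show minus: "\<iota> (- a) = - \<iota> a" for a using add[of a "- a"] by (simp add: zero eq_neg_iff_add_eq_0 add.commute)
  show "\<iota> (a - b) = \<iota> a - \<iota> b" using add[of a "- b"] by (simp add: minus)
  show eq0: "\<iota> a = 0 \<longleftrightarrow> a = 0" for a
    using mult[of a "inverse a"] by (cases "a = 0") (auto simp: zero one)
  show inv: "\<iota> (inverse a) = inverse (\<iota> a)" for a
    using mult[of a "inverse a"] by (cases "a = 0") (auto simp: zero one inverse_unique)
  show "\<iota> (a / b) = \<iota> a / \<iota> b" by (simp add: divide_inverse mult inv)
  show "\<iota> (a ^ n) = \<iota> a ^ n" by (induction n) (auto simp: one mult)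
qed

text \<open>The independent set \<open>{1}\<close> extends to a basis, which has two elements;
  \<alpha> is the other one.\<close>

lemma quadratic_ext_generator:
  fixes \<iota> :: "'k::field \<Rightarrow> 'l::field"
  assumes "quadratic_ext \<iota>"
  shows "\<exists>\<alpha>. \<forall>x. \<exists>a b. x = \<iota> a + \<iota> b * \<alpha>"
proof -
  have emb: "field_embedding \<iota>" and dim: "vector_space.dim (\<lambda>a x. \<iota> a * x) (UNIV :: 'l set) = 2"
    using assms by (auto simp: quadratic_ext_def)
  note emb_simps = field_embedding_simps[OF emb]
  interpret vs: vector_space "\<lambda>a x. \<iota> a * x"
    by unfold_locales (simp_all add: emb_simps algebra_simps)
  have "vs.independent {1}" by (simp add: vs.dependent_single)
  then obtain B where B: "{1} \<subseteq> B" "vs.independent B" "UNIV \<subseteq> vs.span B"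
    using vs.maximal_independent_subset_extend[of "{1}" UNIV] by auto
  then have "card B = 2" using vs.basis_card_eq_dim[of B UNIV] dim by simp
  then obtain \<alpha> where "B = {\<alpha>, 1}" using B(1) by (auto simp: card_2_iff)
  then have "x \<in> vs.span {\<alpha>, 1}" for x using B(3) by auto
  then have "\<exists>b a. x - \<iota> b * \<alpha> = \<iota> a * 1" for x
    by (simp add: vs.span_insert vs.span_singleton)
  then show ?thesis by (metis diff_add_cancel mult.right_neutral)
qed

locale galois_quadratic =
  fixes \<iota> :: "'k::field \<Rightarrow> 'l::field" and \<sigma> :: "'l \<Rightarrow> 'l"
  assumes quad: "quadratic_ext \<iota>" and aut: "nontrivial_automorphism \<iota> \<sigma>"
begin

lemma emb: "field_embedding \<iota>" using quad by (simp add: quadratic_ext_def)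

lemma aut_emb: "field_embedding \<sigma>" using aut by (simp add: nontrivial_automorphism_def)

lemmas emb_simps = field_embedding_simps[OF emb]
lemmas aut_simps = field_embedding_simps[OF aut_emb]

lemma fixed: "\<sigma> (\<iota> a) = \<iota> a" using aut by (simp add: nontrivial_automorphism_def)

text \<open>Applying \<sigma> to the quadratic equation of \<alpha> over \<open>K\<close> shows that
  \<sigma> \<alpha> is a root too. It differs from \<alpha>, since otherwise \<sigma> would be the
  identity; so it is the second root, and the two roots add up to \<open>\<iota> p\<close>.\<close>

lemma aut_conjugates:
  "\<exists>\<alpha> p q. (\<forall>x. \<exists>a b. x = \<iota> a + \<iota> b * \<alpha>) \<and> \<sigma> \<alpha> = \<iota> p - \<alpha> \<and> \<alpha> * \<alpha> = \<iota> q + \<iota> p * \<alpha>"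
proof -
  obtain \<alpha> where \<alpha>: "\<And>x. \<exists>a b. x = \<iota> a + \<iota> b * \<alpha>" using quadratic_ext_generator[OF quad] by blast
  obtain p q where pq: "\<alpha> * \<alpha> = \<iota> q + \<iota> p * \<alpha>" using \<alpha> by blast
  have "\<sigma> \<alpha> * \<sigma> \<alpha> = \<iota> q + \<iota> p * \<sigma> \<alpha>" using arg_cong[OF pq, of \<sigma>] by (simp add: aut_simps fixed)
  then have "(\<alpha> - \<sigma> \<alpha>) * (\<alpha> + \<sigma> \<alpha> - \<iota> p) = 0" using pq by (simp add: algebra_simps)
  moreover have "\<sigma> \<alpha> \<noteq> \<alpha>"
  proof
    assume *: "\<sigma> \<alpha> = \<alpha>"
    have "\<sigma> x = x" for x
    proof -
      obtain a b where "x = \<iota> a + \<iota> b * \<alpha>" using \<alpha> by blast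
      then show ?thesis by (simp add: aut_simps fixed *)
    qed
    then have "\<sigma> = id" by auto
    then show False using aut by (simp add: nontrivial_automorphism_def)
  qed
  ultimately have "\<alpha> + \<sigma> \<alpha> - \<iota> p = 0" by (metis eq_iff_diff_eq_0 mult_eq_0_iff)
  then have "\<sigma> \<alpha> = \<iota> p - \<alpha>" by (simp add: algebra_simps)
  then show ?thesis using \<alpha> pq by blast
qed

lemma aut_aut: "\<sigma> (\<sigma> x) = x"
proof -
  obtain \<alpha> p q where \<alpha>: "\<And>x. \<exists>a b. x = \<iota> a + \<iota> b * \<alpha>" "\<sigma> \<alpha> = \<iota> p - \<alpha>" "\<alpha> * \<alpha> = \<iota> q + \<iota> p * \<alpha>"
    using aut_conjugates by blast
  obtain a b where "x = \<iota> a + \<iota> b * \<alpha>" using \<alpha>(1) by blast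
  then show ?thesis by (simp add: aut_simps fixed \<alpha>(2))
qed

lemma trace_norm_in_range: "\<exists>t. x + \<sigma> x = \<iota> t" "\<exists>n. x * \<sigma> x = \<iota> n"
proof -
  obtain \<alpha> p q where \<alpha>: "\<And>x. \<exists>a b. x = \<iota> a + \<iota> b * \<alpha>" "\<sigma> \<alpha> = \<iota> p - \<alpha>" "\<alpha> * \<alpha> = \<iota> q + \<iota> p * \<alpha>"
    using aut_conjugates by blast
  obtain a b where x: "x = \<iota> a + \<iota> b * \<alpha>" using \<alpha>(1) by blast
  have two: "\<iota> 2 = 2" using emb_simps(2)[of 1 1] by (simp add: emb_simps(1))
  have "x + \<sigma> x = \<iota> (a + a + b * p)" by (simp add: x aut_simps fixed \<alpha>(2) emb_simps two algebra_simps)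
  then show "\<exists>t. x + \<sigma> x = \<iota> t" by blast
  have "x * \<sigma> x = \<iota> a * \<iota> a + \<iota> a * \<iota> b * \<iota> p + \<iota> b * \<iota> b * (\<iota> p * \<alpha> - \<alpha> * \<alpha>)"
    by (simp add: x aut_simps fixed \<alpha>(2) algebra_simps)
  also have "\<dots> = \<iota> (a * a + a * b * p - b * b * q)" by (simp add: \<alpha>(3) emb_simps algebra_simps)
  finally show "\<exists>n. x * \<sigma> x = \<iota> n" by blast
qed

lemma not_all_in_range: "\<exists>x. x \<notin> range \<iota>"
proof (rule ccontr)
  assume "\<not> ?thesis"
  then have "\<sigma> x = x" for x using fixed by (metis imageE)
  then have "\<sigma> = id" by auto
  then show False using aut by (simp add: nontrivial_automorphism_def)
qed

end

locale unramified_quadratic = galois_quadratic \<iota> \<sigma> + valued_field \<omega>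
  for \<iota> :: "'k::field \<Rightarrow> 'l::field" and \<sigma> :: "'l \<Rightarrow> 'l" and \<omega> :: "'l \<Rightarrow> ereal" +
  assumes loc: "nonarch_local_field (\<omega> \<circ> \<iota>)" and unram: "unramified \<iota> \<omega>"
begin

lemma val_range: assumes "x \<noteq> 0" shows "\<exists>k. k \<noteq> 0 \<and> \<omega> (\<iota> k) = \<omega> x"
proof -
  have "\<omega> x \<in> (\<omega> \<circ> \<iota>) ` (- {0})" using unram assms unfolding unramified_def by auto
  then show ?thesis by auto
qed

text \<open>\<open>K\<close> is complete for the restricted valuation, hence closed in
  \<open>L\<close>. Completeness enters the proof only here.\<close>

lemma range_closed:
  assumes "\<And>c :: real. \<exists>k. ereal c \<le> \<omega> (x - \<iota> k)"
  shows "x \<in> range \<iota>"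
proof -
  have "\<forall>n :: nat. \<exists>k. ereal (real n) \<le> \<omega> (x - \<iota> k)" using assms by blast
  then obtain X where X: "\<And>n :: nat. ereal (real n) \<le> \<omega> (x - \<iota> (X n))" by metis
  have close: "ereal c \<le> \<omega> (x - \<iota> (X n))" if "nat \<lceil>c\<rceil> \<le> n" for c n
  proof -
    have "c \<le> real n" using that by linarith
    then show ?thesis using X[of n] by (meson ereal_less_eq(3) order_trans)
  qed
  have "\<exists>N. \<forall>m\<ge>N. \<forall>n\<ge>N. ereal c \<le> (\<omega> \<circ> \<iota>) (X m - X n)" for c :: real
  proof (intro exI allI impI)
    fix m n assume "nat \<lceil>c\<rceil> \<le> m" "nat \<lceil>c\<rceil> \<le> n"
    then have "ereal c \<le> \<omega> ((x - \<iota> (X n)) - (x - \<iota> (X m)))" by (intro val_diff close)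
    then show "ereal c \<le> (\<omega> \<circ> \<iota>) (X m - X n)" by (simp add: emb_simps)
  qed
  then obtain l where l: "\<And>c :: real. \<exists>N. \<forall>n\<ge>N. ereal c \<le> (\<omega> \<circ> \<iota>) (X n - l)"
    using loc unfolding nonarch_local_field_def complete_val_def by blast
  have "ereal c \<le> \<omega> (x - \<iota> l)" for c :: real
  proof -
    obtain N where N: "\<And>n. n \<ge> N \<Longrightarrow> ereal c \<le> \<omega> (\<iota> (X n) - \<iota> l)" using l[of c] by (auto simp: emb_simps)
    define n where "n = max N (nat \<lceil>c\<rceil>)"
    have "ereal c \<le> \<omega> ((x - \<iota> (X n)) + (\<iota> (X n) - \<iota> l))"
      by (intro val_add close N) (auto simp: n_def)
    then show ?thesis by simp
  qed
  then have "\<omega> (x - \<iota> l) = \<infinity>" by (rule ereal_top)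
  then show ?thesis by (simp add: range_eqI)
qed

text \<open>
  If \<open>\<sigma> x\<close> were not a unit, iterating \<open>k \<mapsto> t - n / k\<close> (with \<open>t\<close>, \<open>n\<close> the trace and norm of \<open>x\<close>)
  would produce elements of \<open>K\<close> converging to the root \<open>x\<close> of its characteristic polynomial.
\<close>
lemma val_aut_le: assumes "\<omega> x = 0" shows "\<omega> (\<sigma> x) \<le> 0"
proof (rule ccontr)
  assume "\<not> ?thesis"
  then have pos: "0 < \<omega> (\<sigma> x)" by simp
  have x: "x \<noteq> 0" "\<sigma> x \<noteq> 0" using assms aut_simps(7)[of x] by auto
  define c where "c = v (\<sigma> x)"
  have c: "\<omega> (\<sigma> x) = ereal c" "0 < c" using pos x val_eq_v by (auto simp: c_def)
  obtain t n where t: "x + \<sigma> x = \<iota> t" and n: "x * \<sigma> x = \<iota> n" using trace_norm_in_range by blast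
  \<comment> \<open>The iteration starts at \<open>t\<close>, whose error is already \<sigma> x;
    hence \<open>m\<close> steps reach \<open>Suc m\<close> multiples of \<open>c\<close>.\<close>
  have approx: "\<exists>k. ereal (real (Suc m) * c) \<le> \<omega> (\<iota> k - x)" for m
  proof (induction m)
    case 0
    show ?case using c by (intro exI[of _ t]) (simp add: t[symmetric])
  next
    case (Suc m)
    then obtain k where k: "ereal (real (Suc m) * c) \<le> \<omega> (\<iota> k - x)" by blast
    have "0 < ereal (real (Suc m) * c)" using c(2) by simp
    \<comment> \<open>An approximation of positive precision to the unit \<open>x\<close> is a unit,
      so dividing by it loses no precision.\<close>
    then have "\<omega> x < \<omega> (\<iota> k - x)" unfolding assms using k by (rule less_le_trans)
    then have k0: "\<omega> (\<iota> k) = 0" using val_eq_of_diff[of x "\<iota> k"] assms by simp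
    then have nz: "\<iota> k \<noteq> 0" by auto
    define w where "w = inverse (\<iota> k * x)"
    have "v w = 0" using nz x k0 assms by (simp add: w_def v_inverse v_mult) (simp add: v_def)
    then have w: "\<omega> w = 0" using nz x by (simp add: w_def val_eq_v)
    \<comment> \<open>The new error is the old one times \<open>\<sigma> x / \<iota> k\<close>,
      which gains exactly \<open>c\<close>.\<close>
    have "\<iota> (t - n / k) - x = \<sigma> x * (x * w) * (\<iota> k - x)"
      using nz x by (simp add: emb_simps t[symmetric] n[symmetric] w_def field_simps)
    then have "\<omega> (\<iota> (t - n / k) - x) = ereal c + \<omega> (\<iota> k - x)"
      by (simp add: val_mult w assms c)
    moreover have "ereal c + ereal (real (Suc m) * c) \<le> ereal c + \<omega> (\<iota> k - x)" using k by (rule add_left_mono)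
    ultimately have "ereal (real (Suc (Suc m)) * c) \<le> \<omega> (\<iota> (t - n / k) - x)" by (simp add: algebra_simps)
    then show ?case by blast
  qed
  have "x \<in> range \<iota>"
  proof (rule range_closed)
    fix C :: real
    obtain m :: nat where "C / c < real m" using reals_Archimedean2 by blast
    then have "C \<le> real (Suc m) * c" using c(2) by (simp add: field_simps)
    moreover obtain k where "ereal (real (Suc m) * c) \<le> \<omega> (\<iota> k - x)" using approx by blast
    ultimately have "ereal C \<le> \<omega> (- (\<iota> k - x))" unfolding val_uminus by (meson ereal_less_eq(3) order_trans)
    then show "\<exists>k. ereal C \<le> \<omega> (x - \<iota> k)" by auto
  qed
  \<comment> \<open>An element of \<open>K\<close> is fixed by \<sigma>, so
    \<open>\<sigma> x = x\<close> would have valuation zero.\<close>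
  then show False using fixed assms pos by auto
qed

text \<open>As the extension is unramified, any nonzero element becomes a unit after division by an
  element of \<open>K\<close>, which \<sigma> fixes. This extends the inequality from units to all
  elements; applying it also to \<open>\<sigma> x\<close> gives equality because \<sigma> is an
  involution.\<close>

lemma val_aut: "\<omega> (\<sigma> x) = \<omega> x"
proof (cases "x = 0")
  case False
  have unit: "\<omega> (y / \<iota> k) = 0" "\<omega> (\<sigma> (y / \<iota> k)) = ereal (v (\<sigma> y) - v y)"
    if "\<omega> (\<iota> k) = \<omega> y" "y \<noteq> 0" for y k
  proof -
    have "\<omega> (\<iota> k) \<noteq> \<infinity>" unfolding that(1) using that(2) by simp
    then have nz: "\<iota> k \<noteq> 0" "\<sigma> y \<noteq> 0" using that(2) aut_simps(7)[of y] by auto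
    have "v (\<iota> k) = v y" using that by (simp add: v_def)
    then show "\<omega> (y / \<iota> k) = 0" "\<omega> (\<sigma> (y / \<iota> k)) = ereal (v (\<sigma> y) - v y)"
      using nz that(2) by (simp_all add: val_eq_v v_divide aut_simps fixed zero_ereal_def)
  qed
  have le: "v (\<sigma> y) \<le> v y" if "y \<noteq> 0" for y
  proof -
    obtain k where "\<omega> (\<iota> k) = \<omega> y" using val_range \<open>y \<noteq> 0\<close> by blast
    note u = unit[OF this that]
    have "ereal (v (\<sigma> y) - v y) \<le> 0" using val_aut_le[OF u(1)] unfolding u(2) .
    then show ?thesis by (simp add: zero_ereal_def)
  qed
  have "\<sigma> x \<noteq> 0" using False aut_simps(7)[of x] by simp
  then have "v (\<sigma> x) = v x" using le[OF False] le[of "\<sigma> x"] by (simp add: aut_aut)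
  then show ?thesis using val_eq_v[OF False] val_eq_v[OF \<open>\<sigma> x \<noteq> 0\<close>] by simp
qed (simp add: aut_simps(4))

text \<open>The value groups of \<open>K\<close> and \<open>L\<close> agree, so a generator for
  \<open>K\<close> also has the least positive valuation in \<open>L\<close>.\<close>

lemma uniformiser_range:
  "\<exists>p. p \<noteq> 0 \<and> 0 < v (\<iota> p) \<and> (\<forall>x. 0 < \<omega> x \<longrightarrow> ereal (v (\<iota> p)) \<le> \<omega> x)"
proof -
  have "discrete_val (\<omega> \<circ> \<iota>)" using loc by (simp only: nonarch_local_field_def)
  then obtain p where p: "p \<noteq> 0" "0 < \<omega> (\<iota> p)" "\<And>x. x \<noteq> 0 \<Longrightarrow> \<exists>n :: int. \<omega> (\<iota> x) = \<omega> (\<iota> (p powi n))"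
    unfolding discrete_val_def o_def by blast
  have nz: "\<iota> p \<noteq> 0" using p(1) by (simp add: emb_simps)
  then have pos: "0 < v (\<iota> p)" using p(2) by (simp add: val_eq_v)
  have "ereal (v (\<iota> p)) \<le> \<omega> x" if "0 < \<omega> x" for x
  proof (cases "x = 0")
    case False
    then obtain k where k: "k \<noteq> 0" "\<omega> (\<iota> k) = \<omega> x" using val_range by blast
    obtain n :: int where n: "\<omega> (\<iota> k) = \<omega> (\<iota> (p powi n))" using p(3) k(1) by blast
    have "v (\<iota> (p powi n)) = real_of_int n * v (\<iota> p)"
      using nz by (cases n rule: int_cases2) (simp_all add: power_int_minus emb_simps v_power v_inverse)
    then have *: "\<omega> x = ereal (real_of_int n * v (\<iota> p))"
      using n k nz by (simp add: val_eq_v emb_simps)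
    then have "0 < n" using that pos by (simp add: zero_less_mult_iff)
    then have "1 \<le> real_of_int n" by simp
    then show ?thesis using * pos by simp
  qed simp
  then show ?thesis using p(1) pos by blast
qed

section \<open>Residue fields and an element of trace one\<close>

text \<open>Pigeonhole in the finite residue field of \<open>K\<close>. It will be applied to the
  iterated squares of a norm, to show that Frobenius is eventually periodic on it.\<close>

lemma finite_residue:
  assumes "\<And>i :: nat. 0 \<le> \<omega> (\<iota> (f i))"
  shows "\<exists>i j. i < j \<and> 0 < \<omega> (\<iota> (f i) - \<iota> (f j))"
proof -
  let ?C = "\<lambda>i. max_ideal (\<omega> \<circ> \<iota>) +>\<^bsub>val_ring (\<omega> \<circ> \<iota>)\<^esub> (f i)"
  have mem: "x \<in> ?C i \<longleftrightarrow> (\<exists>h. 0 < \<omega> (\<iota> h) \<and> x = h + f i)" for x i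
    by (auto simp: a_r_coset_def' max_ideal_def val_ring_def)
  have "?C i \<in> carrier (val_ring (\<omega> \<circ> \<iota>) Quot max_ideal (\<omega> \<circ> \<iota>))" for i
    using assms[of i] by (auto simp: FactRing_def A_RCOSETS_def' val_ring_def)
  then have "range ?C \<subseteq> carrier (val_ring (\<omega> \<circ> \<iota>) Quot max_ideal (\<omega> \<circ> \<iota>))" by blast
  then have "finite (range ?C)" using loc unfolding nonarch_local_field_def by (meson finite_subset)
  then have "\<not> inj ?C" using finite_imageD by blast
  then obtain i j where ij: "i \<noteq> j" "?C i = ?C j" unfolding inj_def by blast
  define a b where "a = min i j" and "b = max i j"
  have "?C a = ?C b" "a < b" using ij by (auto simp: a_def b_def min_def max_def)
  have "f a \<in> ?C a" unfolding mem by (intro exI[of _ 0]) (simp add: emb_simps)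
  then have "f a \<in> ?C b" using \<open>?C a = ?C b\<close> by simp
  then obtain h where "0 < \<omega> (\<iota> h)" "f a = h + f b" using mem by blast
  then have "0 < \<omega> (\<iota> (f a) - \<iota> (f b))" by (simp add: emb_simps)
  then show ?thesis using \<open>a < b\<close> by blast
qed

lemma val_mult_pos: "0 < \<omega> x \<Longrightarrow> 0 \<le> \<omega> y \<Longrightarrow> 0 < \<omega> (x * y)"
  by (cases "\<omega> x"; cases "\<omega> y") (auto simp: val_mult)

text \<open>Injectivity of Frobenius in residue characteristic two: \<open>(a - b) ^ 2\<close>
  differs from \<open>a ^ 2 - b ^ 2\<close> by a multiple of 2.\<close>

lemma val_square_diff:
  assumes "0 < \<omega> 2" "0 \<le> \<omega> a" "0 \<le> \<omega> b" "0 < \<omega> (a ^ 2 - b ^ 2)"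
  shows "0 < \<omega> (a - b)"
proof -
  have "0 < \<omega> ((a ^ 2 - b ^ 2) + 2 * (- (b * (a - b))))"
    using assms by (intro val_add_less val_mult_pos) (auto simp: val_mult intro!: add_nonneg_nonneg val_diff)
  also have "(a ^ 2 - b ^ 2) + 2 * (- (b * (a - b))) = (a - b) * (a - b)"
    by (simp add: power2_eq_square algebra_simps)
  finally show ?thesis by (cases "\<omega> (a - b)") (auto simp: val_mult)
qed

text \<open>
  If no integral trace is a unit, then \<open>\<sigma>\<close> acts as \<open>- 1\<close> on the residue field and \<open>2 = 0\<close> there.
  Hence \<open>x\<^sup>2\<close> is congruent to the norm of \<open>x\<close>, which is a square modulo the maximal ideal of \<open>K\<close>
  because the Frobenius map of the finite residue field of \<open>K\<close> is bijective. So \<open>L\<close> and \<open>K\<close> have the same residue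
  field, and as the extension is unramified and \<open>K\<close> complete, \<open>L = K\<close>.
\<close>
lemma trace_one: "\<exists>\<theta>. 0 \<le> \<omega> \<theta> \<and> \<theta> + \<sigma> \<theta> = 1"
proof (rule ccontr)
  assume none: "\<not> ?thesis"
  \<comment> \<open>A unit trace is fixed by \<sigma>, so dividing \<open>x\<close> by it would
    produce the excluded element of trace one.\<close>
  have tr: "0 < \<omega> (x + \<sigma> x)" if x: "0 \<le> \<omega> x" for x
  proof (rule ccontr)
    assume *: "\<not> ?thesis"
    have "0 \<le> \<omega> (x + \<sigma> x)" using x by (intro val_add) (simp_all add: val_aut)
    with * have t: "\<omega> (x + \<sigma> x) = 0" by simp
    then have nz: "x + \<sigma> x \<noteq> 0" by auto
    have "\<sigma> (x + \<sigma> x) = x + \<sigma> x" by (simp add: aut_simps aut_aut add.commute)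
    then have "x / (x + \<sigma> x) + \<sigma> (x / (x + \<sigma> x)) = 1"
      using nz by (simp add: aut_simps(9) add_divide_distrib[symmetric])
    moreover have "0 \<le> \<omega> (x / (x + \<sigma> x))"
    proof (cases "x = 0")
      case False
      then show ?thesis using x nz t by (simp add: val_eq_v v_divide)
    qed simp
    ultimately show False using none by blast
  qed
  have two: "0 < \<omega> 2" using tr[of 1] by (simp add: aut_simps)
  have pow: "0 \<le> \<omega> (x ^ m)" if "0 \<le> \<omega> x" for x m
    using that by (induction m) (auto simp: val_mult)
  have residue: "\<exists>k. 0 < \<omega> (x - \<iota> k)" if x: "0 \<le> \<omega> x" for x
  proof -
    obtain n where n: "x * \<sigma> x = \<iota> n" using trace_norm_in_range by blast
    have n0: "0 \<le> \<omega> (\<iota> n)" using x n[symmetric] by (simp add: val_mult val_aut)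
    obtain i j where ij: "i < j" "0 < \<omega> (\<iota> (n ^ 2 ^ i) - \<iota> (n ^ 2 ^ j))"
      using finite_residue[of "\<lambda>i. n ^ 2 ^ i"] pow[OF n0] by (auto simp: emb_simps)
    \<comment> \<open>Cancelling \<open>i\<close> squarings by injectivity of Frobenius turns
      eventual periodicity into periodicity. Then \<open>n\<close> is congruent to a proper iterated
      square of itself, hence to a square.\<close>
    have "0 < \<omega> (\<iota> n ^ 2 ^ i - \<iota> n ^ 2 ^ (i + m)) \<Longrightarrow> 0 < \<omega> (\<iota> n - \<iota> n ^ 2 ^ m)" for m
    proof (induction i)
      case (Suc i)
      have "\<iota> n ^ 2 ^ Suc i = (\<iota> n ^ 2 ^ i) ^ 2" "\<iota> n ^ 2 ^ (Suc i + m) = (\<iota> n ^ 2 ^ (i + m)) ^ 2"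
        by (simp_all add: power_mult[symmetric] mult.commute)
      then have "0 < \<omega> ((\<iota> n ^ 2 ^ i) ^ 2 - (\<iota> n ^ 2 ^ (i + m)) ^ 2)" using Suc.prems by (simp only:)
      then show ?case by (intro Suc.IH val_square_diff[OF two pow[OF n0] pow[OF n0]])
    qed simp
    from this[of "j - i"] have "0 < \<omega> (\<iota> n - \<iota> n ^ 2 ^ (j - i))" using ij by (simp add: emb_simps)
    moreover obtain m where m: "j - i = Suc m" using ij(1) by (metis Suc_diff_Suc)
    moreover have "\<iota> n ^ 2 ^ Suc m = (\<iota> n ^ 2 ^ m) ^ 2" by (simp add: power_mult[symmetric] mult.commute)
    ultimately have n2: "0 < \<omega> (\<iota> n - (\<iota> n ^ 2 ^ m) ^ 2)" by simp
    have xx: "0 \<le> \<omega> (x * x)" using x by (simp add: val_mult)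
    \<comment> \<open>The three summands are small because 2, the trace of \<open>x\<close>, and the
      norm minus its approximate square root squared are. Together they leave the difference of two
      squares.\<close>
    have "0 < \<omega> (2 * (x * x) + (- ((x + \<sigma> x) * x)) + (\<iota> n - (\<iota> n ^ 2 ^ m) ^ 2))"
      using x by (intro val_add_less n2) (simp_all add: val_mult_pos two tr x xx)
    also have "2 * (x * x) + (- ((x + \<sigma> x) * x)) + (\<iota> n - (\<iota> n ^ 2 ^ m) ^ 2) = x ^ 2 - (\<iota> n ^ 2 ^ m) ^ 2"
      by (simp add: n[symmetric] power2_eq_square algebra_simps)
    finally have "0 < \<omega> (x - \<iota> n ^ 2 ^ m)" using val_square_diff two x pow[OF n0] by blast
    then show ?thesis by (intro exI[of _ "n ^ 2 ^ m"]) (simp add: emb_simps)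
  qed
  obtain p where p: "p \<noteq> 0" "0 < v (\<iota> p)" "\<And>x. 0 < \<omega> x \<Longrightarrow> ereal (v (\<iota> p)) \<le> \<omega> x"
    using uniformiser_range by blast
  have nz: "\<iota> p \<noteq> 0" using p(1) by (simp add: emb_simps)
  \<comment> \<open>Expansion in powers of \<open>p\<close> with digits in \<open>K\<close>: each
    step reads off the next digit as an approximation in \<open>K\<close> to the rescaled error
    \<open>u\<close>.\<close>
  have approx: "\<exists>k. ereal (real m * v (\<iota> p)) \<le> \<omega> (x - \<iota> k)" if "0 \<le> \<omega> x" for x m
  proof (induction m)
    case 0
    then show ?case using that by (intro exI[of _ 0]) (simp add: emb_simps zero_ereal_def)
  next
    case (Suc m)
    then obtain k where k: "ereal (real m * v (\<iota> p)) \<le> \<omega> (x - \<iota> k)" by blast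
    define u where "u = (x - \<iota> k) / \<iota> p ^ m"
    have "0 \<le> \<omega> u"
    proof (cases "x - \<iota> k = 0")
      case False
      then show ?thesis using k nz by (simp add: u_def val_eq_v v_divide v_power)
    qed (simp add: u_def)
    then obtain k' where "0 < \<omega> (u - \<iota> k')" using residue by blast
    then have "ereal (v (\<iota> p)) \<le> \<omega> (u - \<iota> k')" using p(3) by blast
    then have "ereal (real m * v (\<iota> p)) + ereal (v (\<iota> p)) \<le> ereal (real m * v (\<iota> p)) + \<omega> (u - \<iota> k')"
      by (rule add_left_mono)
    also have "\<dots> = \<omega> (\<iota> p ^ m * (u - \<iota> k'))" using nz by (simp add: val_mult val_eq_v[of "\<iota> p ^ m"] v_power)
    also have "\<iota> p ^ m * u = x - \<iota> k" using nz by (simp add: u_def)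
    then have "\<iota> p ^ m * (u - \<iota> k') = x - \<iota> (k + p ^ m * k')" by (simp add: emb_simps right_diff_distrib)
    finally have "ereal (real (Suc m) * v (\<iota> p)) \<le> \<omega> (x - \<iota> (k + p ^ m * k'))" by (simp add: algebra_simps)
    then show ?case by blast
  qed
  have int: "x \<in> range \<iota>" if x: "0 \<le> \<omega> x" for x
  proof (rule range_closed)
    fix C :: real
    obtain m :: nat where "C / v (\<iota> p) < real m" using reals_Archimedean2 by blast
    then have "C \<le> real m * v (\<iota> p)" using p(2) by (simp add: field_simps)
    then show "\<exists>k. ereal C \<le> \<omega> (x - \<iota> k)" using approx[OF x, of m] by (meson ereal_less_eq(3) order_trans)
  qed
  obtain x where x: "x \<notin> range \<iota>" using not_all_in_range by blast
  then have "x \<noteq> 0" by (metis emb_simps(4) rangeI)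
  then obtain k where k: "k \<noteq> 0" "\<omega> (\<iota> k) = \<omega> x" using val_range by blast
  then have nzk: "\<iota> k \<noteq> 0" by (simp add: emb_simps)
  have "\<omega> (x / \<iota> k) = 0" using k(2) nzk \<open>x \<noteq> 0\<close> by (simp add: val_eq_v v_divide zero_ereal_def)
  then obtain a where "x / \<iota> k = \<iota> a" using int[of "x / \<iota> k"] by auto
  then have "x = \<iota> (a * k)" using nzk by (simp add: emb_simps field_simps)
  then show False using x by blast
qed

end

section \<open>The unitary group and its tree\<close>

text \<open>The base field \<open>K\<close> is forgotten here: what remains of it are an involution
  preserving \<omega> and an integral element of trace one. The condition \<open>pi_nz\<close>
  excludes the trivial valuation, whose maximal ideal is generated by 0.\<close>

locale unitary = valued_field \<omega> for \<omega> :: "'l::field \<Rightarrow> ereal" +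
  fixes \<sigma> :: "'l \<Rightarrow> 'l" and \<pi> :: 'l
  assumes unif: "uniformiser \<omega> \<pi>"
    and pi_nz: "\<pi> \<noteq> 0"
    and conj_add: "\<sigma> (x + y) = \<sigma> x + \<sigma> y"
    and conj_mult: "\<sigma> (x * y) = \<sigma> x * \<sigma> y"
    and conj_conj [simp]: "\<sigma> (\<sigma> x) = x"
    and val_conj [simp]: "\<omega> (\<sigma> x) = \<omega> x"
    and trace_one: "\<exists>\<theta>. 0 \<le> \<omega> \<theta> \<and> \<theta> + \<sigma> \<theta> = 1"
begin

lemma v_conj [simp]: "v (\<sigma> x) = v x" by (simp add: v_def)

lemma conj_zero [simp]: "\<sigma> 0 = 0" using conj_add[of 0 0] by (metis add_0 add_left_imp_eq add.right_neutral)

lemma conj_eq_zero [simp]: "\<sigma> x = 0 \<longleftrightarrow> x = 0" by (metis conj_conj conj_zero)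

lemma conj_one [simp]: "\<sigma> 1 = 1"
  using conj_mult[of 1 1] conj_eq_zero[of 1] by simp

lemma conj_uminus: "\<sigma> (- x) = - \<sigma> x"
  using conj_add[of x "- x"] by (simp add: eq_neg_iff_add_eq_0 add.commute)

lemma conj_diff: "\<sigma> (x - y) = \<sigma> x - \<sigma> y"
  using conj_add[of x "- y"] by (simp add: conj_uminus)

lemma conj_inverse: "\<sigma> (inverse x) = inverse (\<sigma> x)"
  using conj_mult[of x "inverse x"] by (cases "x = 0") (auto simp: inverse_unique)

lemma conj_divide: "\<sigma> (x / y) = \<sigma> x / \<sigma> y"
  by (simp add: divide_inverse conj_mult conj_inverse)

lemmas conj_simps = conj_add conj_mult conj_uminus conj_diff conj_inverse conj_divide

text \<open>The adjoint for the hermitian form pairing columns \<open>x\<close> and \<open>y\<close>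
  to \<open>\<sigma> x1 * y3 + \<sigma> x2 * y2 + \<sigma> x3 * y1\<close>. The entry (i, j) of
  \<open>adj g ** g\<close> pairs columns \<open>4 - i\<close> and \<open>j\<close> of
  \<open>g\<close>; on the unitary group \<open>adj\<close> is inversion.\<close>

definition adj :: "'l mat33 \<Rightarrow> 'l mat33" where
  "adj g = antitranspose (map_mat \<sigma> g)"

lemma adj_nth: "adj g $ i $ j = \<sigma> (g $ (4 - j) $ (4 - i))"
  by (simp add: adj_def antitranspose_def map_mat_def)

lemma adj_adj [simp]: "adj (adj g) = g"
  by (simp add: vec_eq_iff adj_nth)

lemma adj_mult: "adj (g ** h) = adj h ** adj g"
  by (simp add: vec_eq_iff adj_nth matrix_matrix_mult_def forall_3 sum_3 conj_simps algebra_simps)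

lemma adj_one [simp]: "adj (mat 1) = mat 1"
  by (simp add: vec_eq_iff adj_nth mat_def forall_3)

lemma det_adj: "det (adj g) = \<sigma> (det g)"
  by (simp add: det_3 adj_nth conj_simps algebra_simps)

lemma SU3_iff: "g \<in> SU3 \<sigma> \<longleftrightarrow> det g = 1 \<and> adj g ** g = mat 1"
  by (simp add: SU3_def adj_def)

lemma SU3_adj_left: "g \<in> SU3 \<sigma> \<Longrightarrow> adj g ** g = mat 1"
  and SU3_adj_right: "g \<in> SU3 \<sigma> \<Longrightarrow> g ** adj g = mat 1"
  by (simp_all add: SU3_iff matrix_left_right_inverse)

lemma SU3_mult: "g \<in> SU3 \<sigma> \<Longrightarrow> h \<in> SU3 \<sigma> \<Longrightarrow> g ** h \<in> SU3 \<sigma>"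
  unfolding SU3_iff adj_mult det_mul
  by (metis matrix_mul_assoc matrix_mul_lid mult_1)

lemma SU3_adj: "g \<in> SU3 \<sigma> \<Longrightarrow> adj g \<in> SU3 \<sigma>"
  using SU3_adj_right[of g] by (simp add: SU3_iff det_adj)

lemma SU3_one: "mat 1 \<in> SU3 \<sigma>" by (simp add: SU3_iff)

lemma matrix_inv_SU3: "g \<in> SU3 \<sigma> \<Longrightarrow> matrix_inv g = adj g"
  unfolding matrix_inv_def using SU3_adj_left[of g] SU3_adj_right[of g]
  by (intro some_equality) (auto, metis matrix_mul_assoc matrix_mul_lid matrix_mul_rid)

text \<open>\<open>V_mat x\<close> is the matrix of differences of these weights. Differences
  telescope, which is why the valuation bounds survive matrix multiplication, also between two
  different points of the line.\<close>

definition wt :: "real \<Rightarrow> 3 \<Rightarrow> real" where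
  "wt x i = (if i = 1 then - x / 2 else if i = 2 then 0 else x / 2)"

lemma V_mat_eq: "V_mat x $ i $ j = wt x i - wt x j"
proof -
  have "\<forall>i j. V_mat x $ i $ j = wt x i - wt x j"
    unfolding forall_3 V_mat_def wt_def by simp
  then show ?thesis by blast
qed

lemma wt_refl: "wt x (4 - i) = - wt x i"
proof -
  have "\<forall>i. wt x (4 - i) = - wt x i" unfolding forall_3 wt_def by simp
  then show ?thesis by blast
qed

text \<open>
  An element \<open>n\<close> of \<open>N\<close> lies in \<open>transporter (\<nu> n x) x\<close>, so that the condition
  \<open>g\<^sup>-\<^sup>1 h n \<in> P\<^sub>x\<close> defining the tree becomes \<open>g\<^sup>-\<^sup>1 h \<in> transporter x y\<close>, in which
  \<open>n\<close> no longer occurs.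
\<close>
definition transporter :: "real \<Rightarrow> real \<Rightarrow> 'l mat33 set" where
  "transporter x y = {g \<in> SU3 \<sigma>. \<forall>i j. ereal (wt x i - wt y j) \<le> \<omega> (g $ i $ j)}"

lemma bt_P_eq: "bt_P \<omega> \<sigma> x = transporter x x"
  by (simp add: bt_P_def transporter_def mat_val_ge_def V_mat_eq)

lemma transporter_SU3: "g \<in> transporter x y \<Longrightarrow> g \<in> SU3 \<sigma>" by (simp add: transporter_def)

lemma transporter_one: "mat 1 \<in> transporter x x" unfolding transporter_def using SU3_one by (auto simp: mat_def)

lemma transporter_mult: assumes "g \<in> transporter x y" "h \<in> transporter y z" shows "g ** h \<in> transporter x z"
proof -
  have "ereal (wt x i - wt z j) \<le> \<omega> (g $ i $ k * h $ k $ j)" for i j k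
  proof -
    have "ereal (wt x i - wt y k) + ereal (wt y k - wt z j) \<le> \<omega> (g $ i $ k) + \<omega> (h $ k $ j)"
      using assms unfolding transporter_def by (intro add_mono) auto
    then show ?thesis by (simp add: val_mult)
  qed
  then have "ereal (wt x i - wt z j) \<le> \<omega> ((g ** h) $ i $ j)" for i j
    by (simp add: matrix_matrix_mult_def sum_3 val_add)
  then show ?thesis using assms by (simp add: transporter_def SU3_mult)
qed

lemma transporter_adj: assumes "g \<in> transporter x y" shows "adj g \<in> transporter y x"
proof -
  have "ereal (wt y i - wt x j) \<le> \<omega> (g $ (4 - j) $ (4 - i))" for i j
  proof -
    have "ereal (wt x (4 - j) - wt y (4 - i)) \<le> \<omega> (g $ (4 - j) $ (4 - i))"
      using assms unfolding transporter_def by blast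
    then show ?thesis by (simp add: wt_refl)
  qed
  then show ?thesis using assms by (simp add: transporter_def SU3_adj adj_nth)
qed

section \<open>Torus, Weyl and unipotent elements\<close>

definition torus_elt :: "'l \<Rightarrow> 'l mat33" where
  "torus_elt z = diag3 0 z (inverse z * \<sigma> z) (inverse (\<sigma> z))"

definition weyl_elt :: "'l \<Rightarrow> 'l mat33" where
  "weyl_elt z = antidiag3 0 z (- (inverse z * \<sigma> z)) (inverse (\<sigma> z))"

text \<open>The first column is (1, a, b); it is isotropic for the hermitian form exactly when
  \<open>b + \<sigma> b + a * \<sigma> a = 0\<close>, the condition under which the matrix is
  unitary.\<close>

definition lower_unip :: "'l \<Rightarrow> 'l \<Rightarrow> 'l mat33" where
  "lower_unip a b = vector [vector [1, 0, 0], vector [a, 1, 0], vector [b, - \<sigma> a, 1]]"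

definition upper_unip :: "'l \<Rightarrow> 'l \<Rightarrow> 'l mat33" where
  "upper_unip a b = vector [vector [1, - \<sigma> a, b], vector [0, 1, a], vector [0, 0, 1]]"

lemma mat33_eqI:
  fixes g h :: "'a mat33"
  assumes "g $ 1 $ 1 = h $ 1 $ 1" "g $ 1 $ 2 = h $ 1 $ 2" "g $ 1 $ 3 = h $ 1 $ 3"
    "g $ 2 $ 1 = h $ 2 $ 1" "g $ 2 $ 2 = h $ 2 $ 2" "g $ 2 $ 3 = h $ 2 $ 3"
    "g $ 3 $ 1 = h $ 3 $ 1" "g $ 3 $ 2 = h $ 3 $ 2" "g $ 3 $ 3 = h $ 3 $ 3"
  shows "g = h"
  using assms by (simp add: vec_eq_iff forall_3)

lemma mult_nth: "((g :: 'l mat33) ** (h :: 'l mat33)) $ i $ j = g $ i $ 1 * h $ 1 $ j + g $ i $ 2 * h $ 2 $ j + g $ i $ 3 * h $ 3 $ j"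
  by (simp add: matrix_matrix_mult_def sum_3)

lemma torus_elt_nth: "torus_elt z $ 1 $ 1 = z" "torus_elt z $ 1 $ 2 = 0" "torus_elt z $ 1 $ 3 = 0"
   "torus_elt z $ 2 $ 1 = 0" "torus_elt z $ 2 $ 2 = \<sigma> z / z" "torus_elt z $ 2 $ 3 = 0"
   "torus_elt z $ 3 $ 1 = 0" "torus_elt z $ 3 $ 2 = 0" "torus_elt z $ 3 $ 3 = 1 / \<sigma> z"
  by (simp_all add: torus_elt_def diag3_def divide_inverse mult.commute)

lemma weyl_elt_nth: "weyl_elt z $ 1 $ 1 = 0" "weyl_elt z $ 1 $ 2 = 0" "weyl_elt z $ 1 $ 3 = z"
   "weyl_elt z $ 2 $ 1 = 0" "weyl_elt z $ 2 $ 2 = - (\<sigma> z / z)" "weyl_elt z $ 2 $ 3 = 0"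
   "weyl_elt z $ 3 $ 1 = 1 / \<sigma> z" "weyl_elt z $ 3 $ 2 = 0" "weyl_elt z $ 3 $ 3 = 0"
  by (simp_all add: weyl_elt_def antidiag3_def divide_inverse mult.commute)

lemma lower_unip_nth: "lower_unip a b $ 1 $ 1 = 1" "lower_unip a b $ 1 $ 2 = 0" "lower_unip a b $ 1 $ 3 = 0"
   "lower_unip a b $ 2 $ 1 = a" "lower_unip a b $ 2 $ 2 = 1" "lower_unip a b $ 2 $ 3 = 0"
   "lower_unip a b $ 3 $ 1 = b" "lower_unip a b $ 3 $ 2 = - \<sigma> a" "lower_unip a b $ 3 $ 3 = 1"
  by (simp_all add: lower_unip_def)

lemma upper_unip_nth: "upper_unip a b $ 1 $ 1 = 1" "upper_unip a b $ 1 $ 2 = - \<sigma> a" "upper_unip a b $ 1 $ 3 = b"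
   "upper_unip a b $ 2 $ 1 = 0" "upper_unip a b $ 2 $ 2 = 1" "upper_unip a b $ 2 $ 3 = a"
   "upper_unip a b $ 3 $ 1 = 0" "upper_unip a b $ 3 $ 2 = 0" "upper_unip a b $ 3 $ 3 = 1"
  by (simp_all add: upper_unip_def)

lemma mat1_nth: "(mat 1 :: 'l mat33) $ 1 $ 1 = 1" "(mat 1 :: 'l mat33) $ 1 $ 2 = 0" "(mat 1 :: 'l mat33) $ 1 $ 3 = 0"
   "(mat 1 :: 'l mat33) $ 2 $ 1 = 0" "(mat 1 :: 'l mat33) $ 2 $ 2 = 1" "(mat 1 :: 'l mat33) $ 2 $ 3 = 0"
   "(mat 1 :: 'l mat33) $ 3 $ 1 = 0" "(mat 1 :: 'l mat33) $ 3 $ 2 = 0" "(mat 1 :: 'l mat33) $ 3 $ 3 = 1"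
  by (simp_all add: mat_def)

lemmas nth_simps = torus_elt_nth weyl_elt_nth lower_unip_nth upper_unip_nth mat1_nth

lemma torus_elt_SU3: assumes "z \<noteq> 0" shows "torus_elt z \<in> SU3 \<sigma>"
proof -
  have "adj (torus_elt z) ** torus_elt z = mat 1"
    by (rule mat33_eqI) (use assms in \<open>simp_all add: mult_nth adj_nth nth_simps conj_simps\<close>)
  then show ?thesis using assms by (simp add: SU3_iff det_3 nth_simps)
qed

lemma weyl_elt_SU3: assumes "z \<noteq> 0" shows "weyl_elt z \<in> SU3 \<sigma>"
proof -
  have "adj (weyl_elt z) ** weyl_elt z = mat 1"
    by (rule mat33_eqI) (use assms in \<open>simp_all add: mult_nth adj_nth nth_simps conj_simps\<close>)
  then show ?thesis using assms by (simp add: SU3_iff det_3 nth_simps)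
qed

lemma lower_unip_SU3: assumes "b + \<sigma> b + a * \<sigma> a = 0" shows "lower_unip a b \<in> SU3 \<sigma>"
proof -
  have "adj (lower_unip a b) ** lower_unip a b = mat 1"
    by (rule mat33_eqI) (use assms in \<open>simp_all add: mult_nth adj_nth nth_simps conj_simps algebra_simps\<close>)
  then show ?thesis by (simp add: SU3_iff det_3 nth_simps)
qed

lemma upper_unip_SU3: assumes "b + \<sigma> b + a * \<sigma> a = 0" shows "upper_unip a b \<in> SU3 \<sigma>"
proof -
  have "adj (upper_unip a b) ** upper_unip a b = mat 1"
    by (rule mat33_eqI) (use assms in \<open>simp_all add: mult_nth adj_nth nth_simps conj_simps algebra_simps\<close>)
  then show ?thesis by (simp add: SU3_iff det_3 nth_simps)
qed

lemma bt_N_eq: "bt_N \<sigma> = torus_elt ` (- {0}) \<union> weyl_elt ` (- {0})"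
  by (auto simp: bt_N_def bt_T_def bt_M_def torus_elt_def weyl_elt_def)

lemma bt_nu_torus_elt: "z \<noteq> 0 \<Longrightarrow> bt_\<nu> \<omega> \<sigma> (torus_elt z) x = x - 2 * v z"
proof -
  assume "z \<noteq> 0"
  then have "torus_elt z \<in> bt_T \<sigma>" unfolding bt_T_def torus_elt_def by blast
  then show ?thesis by (simp add: bt_\<nu>_def v_def nth_simps)
qed

lemma bt_nu_weyl_elt: "z \<noteq> 0 \<Longrightarrow> bt_\<nu> \<omega> \<sigma> (weyl_elt z) x = - 2 * v z - x"
proof -
  assume "z \<noteq> 0"
  have "weyl_elt z \<noteq> torus_elt w" if "w \<noteq> 0" for w
    using that by (metis weyl_elt_nth(1) torus_elt_nth(1))
  then have "weyl_elt z \<notin> bt_T \<sigma>" unfolding bt_T_def torus_elt_def by auto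
  then show ?thesis by (simp add: bt_\<nu>_def v_def nth_simps)
qed

lemma torus_elt_transporter: assumes "z \<noteq> 0" shows "torus_elt z \<in> transporter (x - 2 * v z) x"
proof -
  have "\<forall>i j. ereal (wt (x - 2 * v z) i - wt x j) \<le> \<omega> (torus_elt z $ i $ j)"
    unfolding forall_3 using assms
    by (simp add: nth_simps wt_def val_eq_v v_divide field_simps)
  then show ?thesis using torus_elt_SU3[OF assms] by (simp add: transporter_def)
qed

lemma weyl_elt_transporter: assumes "z \<noteq> 0" shows "weyl_elt z \<in> transporter (- 2 * v z - x) x"
proof -
  have "\<forall>i j. ereal (wt (- 2 * v z - x) i - wt x j) \<le> \<omega> (weyl_elt z $ i $ j)"
    unfolding forall_3 using assms
    by (simp add: nth_simps wt_def val_eq_v v_divide field_simps)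
  then show ?thesis using weyl_elt_SU3[OF assms] by (simp add: transporter_def)
qed

text \<open>The orbit relation of \<open>N\<close> acting on the real line through \<open>\<nu>\<close>.\<close>
definition same_orbit :: "real \<Rightarrow> real \<Rightarrow> bool" where
  "same_orbit x y \<longleftrightarrow> (\<exists>z. z \<noteq> 0 \<and> (y = x - 2 * v z \<or> y = - 2 * v z - x))"

lemma same_orbit_refl: "same_orbit x x" unfolding same_orbit_def by (rule exI[of _ 1]) simp

lemma same_orbit_minus: "same_orbit x (- x)" unfolding same_orbit_def by (rule exI[of _ 1]) simp

lemma same_orbit_sym: assumes "same_orbit x y" shows "same_orbit y x"
proof -
  obtain z where z: "z \<noteq> 0" "y = x - 2 * v z \<or> y = - 2 * v z - x" using assms same_orbit_def by auto
  show ?thesis using z(2)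
  proof
    assume "y = x - 2 * v z"
    then show ?thesis unfolding same_orbit_def using z(1)
      by (intro exI[of _ "inverse z"]) (simp add: v_inverse)
  next
    assume "y = - 2 * v z - x"
    then show ?thesis unfolding same_orbit_def using z(1) by (intro exI[of _ z]) simp
  qed
qed

lemma same_orbit_trans: assumes "same_orbit x y" "same_orbit y w" shows "same_orbit x w"
proof -
  obtain a where a: "a \<noteq> 0" "y = x - 2 * v a \<or> y = - 2 * v a - x" using assms same_orbit_def by auto
  obtain b where b: "b \<noteq> 0" "w = y - 2 * v b \<or> w = - 2 * v b - y" using assms same_orbit_def by auto
  have *: "same_orbit x (x - 2 * v c)" "same_orbit x (- 2 * v c - x)" if "c \<noteq> 0" for c
    using that unfolding same_orbit_def by blast+
  \<comment> \<open>Composing two maps of the orbit relation multiplies the parameters if the second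
    is a translation, and divides them if it is a reflection.\<close>
  have "w = x - 2 * v (a * b) \<or> w = x - 2 * v (b / a) \<or> w = - 2 * v (a * b) - x \<or> w = - 2 * v (b / a) - x"
    using a b by (auto simp: v_mult v_divide)
  then show ?thesis using * a(1) b(1) by (metis divide_eq_0_iff mult_eq_0_iff)
qed

section \<open>The equivalence relation of the tree\<close>

text \<open>Right multiplication by \<open>n\<close> and by \<open>adj n\<close> passes between the
  two membership conditions, so every \<open>n\<close> with the right action gives the same
  condition; only its existence is left, as \<open>same_orbit\<close>.\<close>

lemma bt_rel_iff:
  "((g, x), (h, y)) \<in> bt_rel \<omega> \<sigma> \<longleftrightarrow>
     g \<in> SU3 \<sigma> \<and> h \<in> SU3 \<sigma> \<and> same_orbit x y \<and> adj g ** h \<in> transporter x y"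
proof -
  have key: "adj g ** h ** n \<in> transporter x x \<longleftrightarrow> adj g ** h \<in> transporter x y" if "n \<in> transporter y x" for n
  proof
    assume "adj g ** h ** n \<in> transporter x x"
    then have "adj g ** h ** n ** adj n \<in> transporter x y" using transporter_adj transporter_mult that by blast
    then show "adj g ** h \<in> transporter x y"
      using SU3_adj_right[OF transporter_SU3[OF that]] by (metis matrix_mul_assoc matrix_mul_rid)
  next
    assume "adj g ** h \<in> transporter x y"
    then show "adj g ** h ** n \<in> transporter x x" using transporter_mult that by blast
  qed
  have "(\<exists>n\<in>bt_N \<sigma>. bt_\<nu> \<omega> \<sigma> n x = y \<and> adj g ** h ** n \<in> transporter x x) \<longleftrightarrow>
    same_orbit x y \<and> adj g ** h \<in> transporter x y"
    unfolding bt_N_eq bex_Un same_orbit_def using key torus_elt_transporter weyl_elt_transporter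
    by (auto simp: bt_nu_torus_elt bt_nu_weyl_elt)
  then show ?thesis unfolding bt_rel_def by (auto simp: matrix_inv_SU3 bt_P_eq)
qed

text \<open>The transporters form a groupoid over the line: identity, \<open>adj\<close> and product
  yield reflexivity, symmetry and transitivity.\<close>

lemma equiv_bt_rel: "equiv (SU3 \<sigma> \<times> UNIV) (bt_rel \<omega> \<sigma>)"
proof (rule equivI)
  show "bt_rel \<omega> \<sigma> \<subseteq> (SU3 \<sigma> \<times> UNIV) \<times> (SU3 \<sigma> \<times> UNIV)" by (auto simp: bt_rel_iff)
  show "refl_on (SU3 \<sigma> \<times> UNIV) (bt_rel \<omega> \<sigma>)"
    by (auto simp: refl_on_def bt_rel_iff same_orbit_refl SU3_adj_left transporter_one)
  show "sym (bt_rel \<omega> \<sigma>)"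
  proof (rule symI, clarify)
    fix g x h y assume *: "((g, x), (h, y)) \<in> bt_rel \<omega> \<sigma>"
    then have "adj (adj g ** h) \<in> transporter y x" by (simp add: bt_rel_iff transporter_adj)
    then show "((h, y), (g, x)) \<in> bt_rel \<omega> \<sigma>" using * by (simp add: bt_rel_iff same_orbit_sym adj_mult)
  qed
  show "trans (bt_rel \<omega> \<sigma>)"
  proof (rule transI, clarify)
    fix g x h y k z
    assume *: "((g, x), (h, y)) \<in> bt_rel \<omega> \<sigma>" "((h, y), (k, z)) \<in> bt_rel \<omega> \<sigma>"
    then have "(adj g ** h) ** (adj h ** k) \<in> transporter x z" by (auto simp: bt_rel_iff intro: transporter_mult)
    moreover have "(adj g ** h) ** (adj h ** k) = adj g ** k"
      using * SU3_adj_right[of h] by (metis bt_rel_iff matrix_mul_assoc matrix_mul_lid)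
    ultimately show "((g, x), (k, z)) \<in> bt_rel \<omega> \<sigma>" using * by (auto simp: bt_rel_iff intro: same_orbit_trans)
  qed
qed

lemma bt_class_eq_iff:
  assumes "g \<in> SU3 \<sigma>" "h \<in> SU3 \<sigma>"
  shows "bt_class \<omega> \<sigma> g x = bt_class \<omega> \<sigma> h y \<longleftrightarrow> same_orbit x y \<and> adj g ** h \<in> transporter x y"
  using eq_equiv_class_iff[OF equiv_bt_rel, of "(g, x)" "(h, y)"] assms
  by (simp add: bt_class_def bt_rel_iff)

lemma bt_act_class:
  assumes "h \<in> SU3 \<sigma>" "g \<in> SU3 \<sigma>"
  shows "bt_act h (bt_class \<omega> \<sigma> g x) = bt_class \<omega> \<sigma> (h ** g) x"
proof -
  have inv: "adj (h ** g) ** k = adj g ** (adj h ** k)" for k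
    by (simp add: adj_mult matrix_mul_assoc)
  have canc: "adj h ** (h ** k) = k" "h ** (adj h ** k) = k" for k
    using assms(1) by (simp_all add: matrix_mul_assoc SU3_adj_left SU3_adj_right)
  have "(k, y) \<in> bt_act h (bt_class \<omega> \<sigma> g x) \<longleftrightarrow> ((g, x), (adj h ** k, y)) \<in> bt_rel \<omega> \<sigma>" for k y
  proof
    assume "(k, y) \<in> bt_act h (bt_class \<omega> \<sigma> g x)"
    then show "((g, x), (adj h ** k, y)) \<in> bt_rel \<omega> \<sigma>"
      unfolding bt_act_def bt_class_def by (auto simp: canc)
  next
    assume "((g, x), (adj h ** k, y)) \<in> bt_rel \<omega> \<sigma>"
    then show "(k, y) \<in> bt_act h (bt_class \<omega> \<sigma> g x)"
      unfolding bt_act_def bt_class_def by (intro image_eqI[of _ _ "(adj h ** k, y)"]) (simp_all add: canc)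
  qed
  moreover have "(k, y) \<in> bt_class \<omega> \<sigma> (h ** g) x \<longleftrightarrow> ((g, x), (adj h ** k, y)) \<in> bt_rel \<omega> \<sigma>" for k y
  proof -
    have "adj h ** k \<in> SU3 \<sigma> \<longleftrightarrow> k \<in> SU3 \<sigma>"
      using assms(1) canc(2)[of k] by (metis SU3_adj SU3_mult)
    then show ?thesis unfolding bt_class_def using assms
      by (simp add: bt_rel_iff inv SU3_mult)
  qed
  ultimately show ?thesis by auto
qed

section \<open>Moving a unipotent element into the stabiliser of the origin\<close>

lemma half_le: assumes "ereal c \<le> \<omega> (a * \<sigma> a)" shows "ereal (c / 2) \<le> \<omega> a"
  using assms by (cases "\<omega> a") (auto simp: val_mult)

text \<open>The norm of \<open>a\<close> is minus the trace of \<open>b\<close>, so twice the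
  valuation of \<open>a\<close> is at least that of \<open>b\<close>. This matches the halves in
  \<open>V_mat\<close>: for unipotent elements the bound on the corner entry implies the other
  bounds.\<close>

lemma norm_val: assumes "b + \<sigma> b + a * \<sigma> a = 0" "ereal c \<le> \<omega> b" shows "ereal (c / 2) \<le> \<omega> a"
proof -
  have "\<omega> (a * \<sigma> a) = \<omega> (b + \<sigma> b)"
    using val_uminus[of "b + \<sigma> b"] minus_unique[OF assms(1)] by (simp del: minus_add_distrib)
  moreover have "ereal c \<le> \<omega> (b + \<sigma> b)" using assms(2) by (intro val_add) auto
  ultimately show ?thesis by (intro half_le) simp
qed

lemma upper_unip_transporter: assumes "b + \<sigma> b + a * \<sigma> a = 0" "ereal (- x) \<le> \<omega> b" shows "upper_unip a b \<in> transporter x x"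
proof -
  have "ereal (- x / 2) \<le> \<omega> a" using norm_val[OF assms] by simp
  then have "\<forall>i j. ereal (wt x i - wt x j) \<le> \<omega> (upper_unip a b $ i $ j)"
    unfolding forall_3 using assms(2) by (simp add: nth_simps wt_def)
  then show ?thesis using upper_unip_SU3[OF assms(1)] by (simp add: transporter_def)
qed

lemma lower_unip_transporter: assumes "b + \<sigma> b + a * \<sigma> a = 0" "ereal x \<le> \<omega> b" shows "lower_unip a b \<in> transporter x x"
proof -
  have "ereal (x / 2) \<le> \<omega> a" using norm_val[OF assms] by simp
  then have "\<forall>i j. ereal (wt x i - wt x j) \<le> \<omega> (lower_unip a b $ i $ j)"
    unfolding forall_3 using assms(2) by (simp add: nth_simps wt_def)
  then show ?thesis using lower_unip_SU3[OF assms(1)] by (simp add: transporter_def)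
qed

text \<open>Comparing first rows forces the parameters: the first row of the left side is
  \<open>b\<close> times the last row of the right factor, which must therefore be
  \<open>lower_unip (a / \<sigma> b) (1 / b)\<close>.\<close>

lemma upper_unip_eq_lower_unip_weyl_elt_lower_unip:
  assumes "b + \<sigma> b + a * \<sigma> a = 0" "b \<noteq> 0"
  shows "upper_unip a b = lower_unip (a / b) (1 / b) ** weyl_elt b ** lower_unip (a / \<sigma> b) (1 / b)"
proof -
  have nz: "\<sigma> b \<noteq> 0" using assms(2) by simp
  have m: "- \<sigma> b = b + a * \<sigma> a"
    using minus_unique[of "\<sigma> b" "b + a * \<sigma> a"] assms(1) by (simp add: algebra_simps)
  show ?thesis
    by (rule mat33_eqI; simp add: mult_nth nth_simps conj_simps assms(2) nz field_simps)
       (use assms(1) in \<open>simp_all add: algebra_simps m\<close>)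
qed

text \<open>In the tree this says that the point given by the unipotent element and \<open>y\<close>
  has a representative in the stabiliser of the origin. If the element fixes the origin or
  \<open>y\<close>, this is immediate. Otherwise \<open>b\<close> is so large that
  \<open>1 / b\<close> is small enough for both lower factors of its factorisation: the left one
  fixes the origin, the right one fixes \<open>y\<close>.\<close>

lemma upper_unip_double_coset:
  assumes "b + \<sigma> b + a * \<sigma> a = 0"
  shows "\<exists>p z. p \<in> transporter 0 0 \<and> same_orbit y z \<and> adj (upper_unip a b) ** p \<in> transporter y z"
proof -
  let ?u = "upper_unip a b"
  have u: "?u \<in> SU3 \<sigma>" using assms upper_unip_SU3 by blast
  consider "ereal 0 \<le> \<omega> b" | "ereal (- y) \<le> \<omega> b" | "\<omega> b < ereal 0" "\<omega> b < ereal (- y)" by fastforce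
  then show ?thesis
  proof cases
    case 1
    then have "?u \<in> transporter 0 0" using upper_unip_transporter[OF assms] by simp
    then show ?thesis using same_orbit_refl transporter_one u SU3_adj_left by metis
  next
    case 2
    then have "adj ?u \<in> transporter y y" using upper_unip_transporter[OF assms] transporter_adj by simp
    then show ?thesis using same_orbit_refl transporter_one by (metis matrix_mul_rid)
  next
    case 3
    then have b: "b \<noteq> 0" "\<sigma> b \<noteq> 0" by auto
    have v: "v b < 0" "v b < - y" using 3 b by (auto simp: val_eq_v)
    \<comment> \<open>The norm equation divided by \<open>b * \<sigma> b\<close>; the elements
      \<open>a / b\<close> and \<open>a / \<sigma> b\<close> have the same norm.\<close>
    have n: "1 / b + \<sigma> (1 / b) + (a / b) * \<sigma> (a / b) = 0"
      "1 / b + \<sigma> (1 / b) + (a / \<sigma> b) * \<sigma> (a / \<sigma> b) = 0"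
    proof -
      have "b * (b * \<sigma> b) + (b * (\<sigma> b * \<sigma> b) + a * (b * (\<sigma> a * \<sigma> b))) = b * \<sigma> b * (b + \<sigma> b + a * \<sigma> a)"
        by (simp add: algebra_simps)
      then have "b * (b * \<sigma> b) + (b * (\<sigma> b * \<sigma> b) + a * (b * (\<sigma> a * \<sigma> b))) = 0" using assms by simp
      then show "1 / b + \<sigma> (1 / b) + (a / b) * \<sigma> (a / b) = 0"
      "1 / b + \<sigma> (1 / b) + (a / \<sigma> b) * \<sigma> (a / \<sigma> b) = 0"
        using b by (simp_all add: conj_simps field_simps)
    qed
    have w: "\<omega> (1 / b) = ereal (- v b)" using b by (simp add: val_eq_v v_divide)
    have P1: "lower_unip (a / b) (1 / b) \<in> transporter 0 0" using v w by (intro lower_unip_transporter n) simp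
    have P2: "lower_unip (a / \<sigma> b) (1 / b) \<in> transporter y y" using v w by (intro lower_unip_transporter n) simp
    let ?p = "lower_unip (a / b) (1 / b)" and ?q = "lower_unip (a / \<sigma> b) (1 / b)"
    \<comment> \<open>The image of \<open>y\<close> under the reflection given by
      \<open>weyl_elt b\<close>.\<close>
    define z where "z = - 2 * v b - y"
    have "weyl_elt b ** ?q \<in> transporter z y" unfolding z_def using weyl_elt_transporter[OF b(1)] P2 transporter_mult by blast
    moreover have "adj ?p ** ?u = weyl_elt b ** ?q"
      unfolding upper_unip_eq_lower_unip_weyl_elt_lower_unip[OF assms b(1)] using SU3_adj_left[OF transporter_SU3[OF P1]]
      by (metis matrix_mul_assoc matrix_mul_lid)
    ultimately have "adj (adj ?p ** ?u) \<in> transporter y z" using transporter_adj by metis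
    then have "adj ?u ** ?p \<in> transporter y z" by (simp add: adj_mult)
    moreover have "same_orbit y z" unfolding same_orbit_def z_def using b by blast
    ultimately show ?thesis using P1 by blast
  qed
qed

section \<open>Lifting isotropic columns\<close>

text \<open>The defect \<open>s\<close> is fixed by \<sigma>, so \<open>\<theta> * s\<close> has
  trace \<open>s\<close>; subtracting it from \<open>b\<close> removes the defect in a single
  step.\<close>

lemma trace_solve:
  assumes "0 \<le> c" "c \<le> \<omega> (b + \<sigma> b + a * \<sigma> a)"
  shows "\<exists>b'. c \<le> \<omega> (b' - b) \<and> b' + \<sigma> b' + a * \<sigma> a = 0"
proof -
  obtain \<theta> where \<theta>: "0 \<le> \<omega> \<theta>" "\<theta> + \<sigma> \<theta> = 1" using trace_one by blast
  define s where "s = b + \<sigma> b + a * \<sigma> a"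
  have s: "\<sigma> s = s" by (simp add: s_def conj_simps algebra_simps)
  have "c \<le> \<omega> (\<theta> * s)" using add_mono[OF \<theta>(1) assms(2)] by (simp add: val_mult s_def)
  moreover have "(b - \<theta> * s) + \<sigma> (b - \<theta> * s) + a * \<sigma> a = s - (\<theta> + \<sigma> \<theta>) * s"
    by (simp add: s conj_simps algebra_simps) (simp add: s_def algebra_simps)
  ultimately show ?thesis by (intro exI[of _ "b - \<theta> * s"]) (simp add: \<theta>(2))
qed

lemma unit_mult_le: "c \<le> \<omega> x \<Longrightarrow> 0 \<le> \<omega> y \<Longrightarrow> c \<le> \<omega> (x * y)"
  using add_mono[of c "\<omega> x" 0 "\<omega> y"] by (simp add: val_mult)

lemma P0_nth: "g \<in> transporter 0 0 \<longleftrightarrow> g \<in> SU3 \<sigma> \<and> (\<forall>i j. 0 \<le> \<omega> (g $ i $ j))"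
proof -
  have "wt 0 i = 0" for i by (simp add: wt_def)
  then show ?thesis by (simp add: transporter_def zero_ereal_def)
qed

text \<open>After division by the unit \<open>x1\<close> the column is (1, a, b), and isotropy is
  the norm equation up to \<open>c\<close>. Only \<open>b\<close> has to be corrected; a torus
  factor restores \<open>x1\<close>.\<close>

lemma column_lift_unit:
  assumes c: "0 \<le> c" and int: "\<omega> x1 = 0" "0 \<le> \<omega> x2" "0 \<le> \<omega> x3"
    and iso: "c \<le> \<omega> (\<sigma> x1 * x3 + \<sigma> x2 * x2 + \<sigma> x3 * x1)"
  shows "\<exists>p \<in> transporter 0 0. c \<le> \<omega> (p $ 1 $ 1 - x1) \<and> c \<le> \<omega> (p $ 2 $ 1 - x2) \<and> c \<le> \<omega> (p $ 3 $ 1 - x3)"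
proof -
  have nz: "x1 \<noteq> 0" "\<sigma> x1 \<noteq> 0" using int(1) by auto
  have inv: "\<omega> (1 / x1) = 0" "\<omega> (1 / \<sigma> x1) = 0" using int(1) nz by (auto simp: val_eq_v v_divide zero_ereal_def)
  define a where "a = x2 / x1"
  define b where "b = x3 / x1"
  have "b + \<sigma> b + a * \<sigma> a = (\<sigma> x1 * x3 + \<sigma> x2 * x2 + \<sigma> x3 * x1) * (1 / x1) * (1 / \<sigma> x1)"
    using nz by (simp add: a_def b_def conj_simps field_simps)
  moreover have "c \<le> \<omega> \<dots>" by (intro unit_mult_le iso) (simp_all add: inv)
  ultimately have "c \<le> \<omega> (b + \<sigma> b + a * \<sigma> a)" by simp
  then obtain b' where b': "c \<le> \<omega> (b' - b)" "b' + \<sigma> b' + a * \<sigma> a = 0" using trace_solve c by blast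
  have "0 \<le> \<omega> b" using unit_mult_le[OF int(3), of "1 / x1"] inv by (simp add: b_def)
  then have "0 \<le> \<omega> b'" using val_add[of 0 "b' - b" b] b'(1) c by (simp add: order_trans)
  then have "lower_unip a b' \<in> transporter 0 0" using lower_unip_transporter[of b' a 0] b'(2) by (simp add: zero_ereal_def)
  moreover have "torus_elt x1 \<in> transporter 0 0" using torus_elt_transporter[OF nz(1), of 0] int(1) by (simp add: v_def)
  ultimately have "lower_unip a b' ** torus_elt x1 \<in> transporter 0 0" by (rule transporter_mult)
  moreover have "c \<le> \<omega> (b' * x1 - x3)"
    using unit_mult_le[OF b'(1), of x1] nz int(1) by (simp add: b_def algebra_simps)
  ultimately show ?thesis
    using nz by (intro bexI[of _ "lower_unip a b' ** torus_elt x1"]) (simp_all add: mult_nth nth_simps a_def)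
qed

text \<open>\<open>c = \<infinity>\<close> gives the exact statement, from which the Iwasawa decomposition follows.\<close>
lemma column_lift:
  assumes c: "0 \<le> c" and int: "0 \<le> \<omega> x1" "0 \<le> \<omega> x2" "0 \<le> \<omega> x3" and unit: "\<omega> x1 = 0 \<or> \<omega> x3 = 0"
    and iso: "c \<le> \<omega> (\<sigma> x1 * x3 + \<sigma> x2 * x2 + \<sigma> x3 * x1)"
  shows "\<exists>p \<in> transporter 0 0. c \<le> \<omega> (p $ 1 $ 1 - x1) \<and> c \<le> \<omega> (p $ 2 $ 1 - x2) \<and> c \<le> \<omega> (p $ 3 $ 1 - x3)"
proof (cases "\<omega> x1 = 0")
  case True
  then show ?thesis using column_lift_unit assms by blast
next
  case False
  \<comment> \<open>\<open>weyl_elt 1\<close> exchanges the outer entries and has -1 in the middle,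
    hence the sign of \<open>x2\<close>.\<close>
  have "\<exists>p \<in> transporter 0 0. c \<le> \<omega> (p $ 1 $ 1 - x3) \<and> c \<le> \<omega> (p $ 2 $ 1 - (- x2)) \<and> c \<le> \<omega> (p $ 3 $ 1 - x1)"
    using assms False by (intro column_lift_unit) (auto simp: conj_simps algebra_simps)
  then obtain p where p: "p \<in> transporter 0 0" "c \<le> \<omega> (p $ 1 $ 1 - x3)" "c \<le> \<omega> (p $ 2 $ 1 + x2)" "c \<le> \<omega> (p $ 3 $ 1 - x1)"
    by auto
  have "weyl_elt 1 ** p \<in> transporter 0 0" using transporter_mult[OF weyl_elt_transporter[of 1 0]] p(1) by simp
  moreover have "c \<le> \<omega> ((weyl_elt 1 ** p) $ 1 $ 1 - x1)" "c \<le> \<omega> ((weyl_elt 1 ** p) $ 3 $ 1 - x3)"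
    using p by (simp_all add: mult_nth nth_simps)
  moreover have "(weyl_elt 1 ** p) $ 2 $ 1 - x2 = - (p $ 2 $ 1 + x2)"
    by (simp add: mult_nth nth_simps)
  then have "c \<le> \<omega> ((weyl_elt 1 ** p) $ 2 $ 1 - x2)"
    using p(3) by (metis val_uminus)
  ultimately show ?thesis by blast
qed

section \<open>Iwasawa decomposition and lifting\<close>

lemma adj_mult_nth: "(adj g ** g) $ i $ j =
   \<sigma> (g $ 3 $ (4 - i)) * g $ 1 $ j + \<sigma> (g $ 2 $ (4 - i)) * g $ 2 $ j + \<sigma> (g $ 1 $ (4 - i)) * g $ 3 $ j"
  by (simp add: mult_nth adj_nth)

lemma SU3_upper:
  assumes g: "g \<in> SU3 \<sigma>" and col: "g $ 1 $ 1 = 1" "g $ 2 $ 1 = 0" "g $ 3 $ 1 = 0"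
  shows "\<exists>a b. b + \<sigma> b + a * \<sigma> a = 0 \<and> g = upper_unip a b"
proof -
  have E: "(adj g ** g) $ i $ j = mat 1 $ i $ j" for i j using SU3_adj_left[OF g] by simp
  have 32: "g $ 3 $ 2 = 0" using E[of 3 2] by (simp add: adj_mult_nth nth_simps col)
  have 33: "g $ 3 $ 3 = 1" using E[of 3 3] by (simp add: adj_mult_nth nth_simps col)
  \<comment> \<open>Unitarity would only give an entry of norm one; the determinant makes it
    1.\<close>
  have 22: "g $ 2 $ 2 = 1" using g by (simp add: SU3_iff det_3 col 32 33)
  have "\<sigma> (g $ 1 $ 2) + g $ 2 $ 3 = 0" using E[of 2 3]
    by (simp add: adj_mult_nth nth_simps 32 33 22 algebra_simps)
  then have "\<sigma> (\<sigma> (g $ 1 $ 2) + g $ 2 $ 3) = 0" by simp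
  then have 12: "g $ 1 $ 2 = - \<sigma> (g $ 2 $ 3)" by (simp add: conj_simps eq_neg_iff_add_eq_0)
  have 13: "g $ 1 $ 3 + \<sigma> (g $ 1 $ 3) + g $ 2 $ 3 * \<sigma> (g $ 2 $ 3) = 0" using E[of 1 3]
    by (simp add: adj_mult_nth nth_simps 33 algebra_simps)
  have "g = upper_unip (g $ 2 $ 3) (g $ 1 $ 3)"
    by (rule mat33_eqI) (simp_all add: nth_simps col 32 33 22 12)
  then show ?thesis using 13 by blast
qed

text \<open>If \<open>x2\<close> had strictly the least valuation, its norm would dominate the other
  two terms and they could not cancel. So an isotropic column attains its minimum at an outer entry,
  as \<open>column_lift\<close> requires.\<close>

lemma isotropic_min:
  assumes "\<sigma> x1 * x3 + \<sigma> x2 * x2 + \<sigma> x3 * x1 = 0"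
  shows "min (\<omega> x1) (\<omega> x3) \<le> \<omega> x2"
proof (rule ccontr)
  assume *: "\<not> min (\<omega> x1) (\<omega> x3) \<le> \<omega> x2"
  then have nz: "x2 \<noteq> 0" by auto
  then have l: "ereal (v x2) < \<omega> x1" "ereal (v x2) < \<omega> x3" using * by (simp_all add: val_eq_v not_le)
  have "ereal (2 * v x2) < \<omega> x1 + \<omega> x3" using l by (cases "\<omega> x1"; cases "\<omega> x3") auto
  then have "ereal (2 * v x2) < \<omega> (\<sigma> x1 * x3 + \<sigma> x3 * x1)"
    by (intro val_add_less) (simp_all add: val_mult add.commute)
  also have "\<sigma> x1 * x3 + \<sigma> x3 * x1 = - (\<sigma> x2 * x2)"
    using minus_unique[of "\<sigma> x2 * x2" "\<sigma> x1 * x3 + \<sigma> x3 * x1"] assms by (simp add: algebra_simps)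
  finally show False using nz by (simp add: val_mult val_eq_v)
qed

text \<open>Scaled by its entry of least valuation, the first column becomes primitive and is
  exactly the first column of some \<open>p\<close> fixing the origin. Removing \<open>p\<close> and
  the scaling leaves a unitary matrix whose first column is the first basis vector.\<close>

lemma Iwasawa:
  assumes h: "h \<in> SU3 \<sigma>"
  shows "\<exists>p a b z. p \<in> transporter 0 0 \<and> b + \<sigma> b + a * \<sigma> a = 0 \<and> z \<noteq> 0 \<and> h = p ** upper_unip a b ** torus_elt z"
proof -
  let ?x1 = "h $ 1 $ 1" and ?x2 = "h $ 2 $ 1" and ?x3 = "h $ 3 $ 1"
  have "(adj h ** h) $ 3 $ 1 = 0" using SU3_adj_left[OF h] by (simp add: nth_simps)
  then have iso: "\<sigma> ?x1 * ?x3 + \<sigma> ?x2 * ?x2 + \<sigma> ?x3 * ?x1 = 0"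
    by (simp add: adj_mult_nth algebra_simps)
  define x where "x = (if \<omega> ?x1 \<le> \<omega> ?x3 then ?x1 else ?x3)"
  have min: "\<omega> x \<le> \<omega> ?x1" "\<omega> x \<le> \<omega> ?x2" "\<omega> x \<le> \<omega> ?x3"
    using isotropic_min[OF iso] by (auto simp: x_def min_def)
  have x: "x \<noteq> 0"
  proof
    assume "x = 0"
    then have "?x1 = 0" "?x2 = 0" "?x3 = 0" using min by auto
    then show False using h by (simp add: SU3_iff det_3)
  qed
  have int: "0 \<le> \<omega> (y / x)" if "\<omega> x \<le> \<omega> y" for y
    using that x by (cases "y = 0") (simp_all add: val_eq_v v_divide)
  have "(\<sigma> ?x1 * ?x3 + \<sigma> ?x2 * ?x2 + \<sigma> ?x3 * ?x1) / (x * \<sigma> x) = 0" using iso by simp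
  then have "\<sigma> (?x1 / x) * (?x3 / x) + \<sigma> (?x2 / x) * (?x2 / x) + \<sigma> (?x3 / x) * (?x1 / x) = 0"
    using x by (simp add: conj_simps add_divide_distrib mult.commute)
  then have "\<exists>p \<in> transporter 0 0. \<infinity> \<le> \<omega> (p $ 1 $ 1 - ?x1 / x) \<and> \<infinity> \<le> \<omega> (p $ 2 $ 1 - ?x2 / x)
      \<and> \<infinity> \<le> \<omega> (p $ 3 $ 1 - ?x3 / x)"
    using x min by (intro column_lift int) (auto simp: x_def)
  then obtain p where p: "p \<in> transporter 0 0"
    and col: "p $ 1 $ 1 = ?x1 / x" "p $ 2 $ 1 = ?x2 / x" "p $ 3 $ 1 = ?x3 / x" by auto
  have pS: "p \<in> SU3 \<sigma>" using p transporter_SU3 by blast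
  have t: "torus_elt (1 / x) \<in> SU3 \<sigma>" "torus_elt x \<in> SU3 \<sigma>" using x torus_elt_SU3 by auto
  define g where "g = adj p ** h ** torus_elt (1 / x)"
  have g: "g \<in> SU3 \<sigma>" unfolding g_def using pS h t by (intro SU3_mult SU3_adj)
  have "g $ i $ 1 = (adj p ** p) $ i $ 1" for i
    by (simp add: g_def mult_nth nth_simps col field_simps add_divide_distrib)
  then have "g $ i $ 1 = mat 1 $ i $ 1" for i using SU3_adj_left[OF pS] by simp
  then obtain a b where ab: "b + \<sigma> b + a * \<sigma> a = 0" "g = upper_unip a b"
    using SU3_upper[OF g] by (auto simp: nth_simps)
  have "torus_elt (1 / x) ** torus_elt x = mat 1"
    by (rule mat33_eqI) (use x in \<open>simp_all add: mult_nth nth_simps conj_simps\<close>)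
  then have "h = p ** g ** torus_elt x"
    unfolding g_def using SU3_adj_right[OF pS]
    by (metis matrix_mul_assoc matrix_mul_lid matrix_mul_rid)
  then show ?thesis using p ab x by blast
qed

text \<open>The torus factor of the Iwasawa decomposition only translates \<open>y\<close>, the
  unipotent factor is handled by \<open>upper_unip_double_coset\<close>, and the left factor already
  fixes the origin.\<close>

lemma bt_class_representative:
  assumes h: "h \<in> SU3 \<sigma>"
  shows "\<exists>p z. p \<in> transporter 0 0 \<and> bt_class \<omega> \<sigma> h y = bt_class \<omega> \<sigma> p z"
proof -
  obtain q a b z where q: "q \<in> transporter 0 0" and ab: "b + \<sigma> b + a * \<sigma> a = 0" and z: "z \<noteq> 0"
    and h_eq: "h = q ** upper_unip a b ** torus_elt z" using Iwasawa[OF h] by blast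
  define y' where "y' = y - 2 * v z"
  have t: "torus_elt z \<in> transporter y' y" unfolding y'_def using torus_elt_transporter z by blast
  have o: "same_orbit y y'" unfolding same_orbit_def y'_def using z by blast
  obtain p w where p: "p \<in> transporter 0 0" "same_orbit y' w" "adj (upper_unip a b) ** p \<in> transporter y' w"
    using upper_unip_double_coset[OF ab] by blast
  have "adj h ** (q ** p) = adj (torus_elt z) ** (adj (upper_unip a b) ** p)"
    unfolding h_eq adj_mult using SU3_adj_left[OF transporter_SU3[OF q]]
    by (metis matrix_mul_assoc matrix_mul_lid)
  then have "adj h ** (q ** p) \<in> transporter y w" using transporter_mult[OF transporter_adj[OF t] p(3)] by simp
  moreover have "q ** p \<in> transporter 0 0" using transporter_mult q p(1) by blast
  ultimately show ?thesis using bt_class_eq_iff[OF h transporter_SU3] same_orbit_trans[OF o p(2)] by blast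
qed

section \<open>Lifting matrices that are unitary up to a congruence\<close>

definition cong_mat :: "ereal \<Rightarrow> 'l mat33 \<Rightarrow> 'l mat33 \<Rightarrow> bool" where
  "cong_mat c g h \<longleftrightarrow> (\<forall>i j. c \<le> \<omega> (g $ i $ j - h $ i $ j))"

lemma cong_mat_mult:
  assumes "\<And>i j. 0 \<le> \<omega> (p $ i $ j)" "cong_mat c g h"
  shows "cong_mat c (p ** g) (p ** h)"
proof -
  have "c \<le> \<omega> (p $ i $ k * (g $ k $ j - h $ k $ j))" for i j k
    using assms unit_mult_le[of c "g $ k $ j - h $ k $ j" "p $ i $ k"] by (simp add: cong_mat_def mult.commute)
  then have "c \<le> \<omega> (p $ i $ 1 * (g $ 1 $ j - h $ 1 $ j) + p $ i $ 2 * (g $ 2 $ j - h $ 2 $ j)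
     + p $ i $ 3 * (g $ 3 $ j - h $ 3 $ j))" for i j by (intro val_add)
  then show ?thesis by (simp add: cong_mat_def mult_nth algebra_simps)
qed

text \<open>The argument of \<open>SU3_upper\<close> with error terms. Each entry is expressed by an
  exact identity in which every summand contains a factor already known to have valuation at least
  \<open>c\<close>, the other factors being integral.\<close>

lemma cong_upper:
  assumes int: "\<And>i j. 0 \<le> \<omega> (g $ i $ j)"
    and det: "c \<le> \<omega> (det g - 1)" and uni: "cong_mat c (adj g ** g) (mat 1)"
    and col: "c \<le> \<omega> (g $ 1 $ 1 - 1)" "c \<le> \<omega> (g $ 2 $ 1)" "c \<le> \<omega> (g $ 3 $ 1)"
  shows "c \<le> \<omega> (g $ 1 $ 3 + \<sigma> (g $ 1 $ 3) + g $ 2 $ 3 * \<sigma> (g $ 2 $ 3))"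
    and "cong_mat c (upper_unip (g $ 2 $ 3) (g $ 1 $ 3)) g"
proof -
  let ?E = "\<lambda>i j. (adj g ** g) $ i $ j"
  have E: "c \<le> \<omega> (?E i j - mat 1 $ i $ j)" for i j using uni by (simp add: cong_mat_def)
  have int': "0 \<le> \<omega> (g $ i $ j * g $ k $ l)" for i j k l
    using unit_mult_le[OF int int] .
  have d: "c \<le> \<omega> (x - y - z - w)" if "c \<le> \<omega> x" "c \<le> \<omega> y" "c \<le> \<omega> z" "c \<le> \<omega> w" for x y z w
    using that by (intro val_diff)
  note I = int int' unit_mult_le val_diff val_add
  have "g $ 3 $ 2 = ?E 3 2 - \<sigma> (g $ 3 $ 1) * g $ 1 $ 2 - \<sigma> (g $ 2 $ 1) * g $ 2 $ 2 - \<sigma> (g $ 1 $ 1 - 1) * g $ 3 $ 2"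
    by (simp add: adj_mult_nth conj_simps algebra_simps)
  moreover have "c \<le> \<omega> \<dots>" using E[of 3 2] col by (intro I) (simp_all add: nth_simps int)
  ultimately have 32: "c \<le> \<omega> (g $ 3 $ 2)" by (simp only:)
  have "g $ 3 $ 3 - 1 = (?E 3 3 - 1) - \<sigma> (g $ 3 $ 1) * g $ 1 $ 3 - \<sigma> (g $ 2 $ 1) * g $ 2 $ 3 - \<sigma> (g $ 1 $ 1 - 1) * g $ 3 $ 3"
    by (simp add: adj_mult_nth conj_simps algebra_simps)
  moreover have "c \<le> \<omega> ((?E 3 3 - 1) - \<sigma> (g $ 3 $ 1) * g $ 1 $ 3 - \<sigma> (g $ 2 $ 1) * g $ 2 $ 3 - \<sigma> (g $ 1 $ 1 - 1) * g $ 3 $ 3)"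
    by (rule d) (use E[of 3 3] col in \<open>simp_all add: nth_simps unit_mult_le int\<close>)
  ultimately have 33: "c \<le> \<omega> (g $ 3 $ 3 - 1)" by (simp only:)
  \<comment> \<open>The expansion of the determinant, solved for the middle entry.\<close>
  have "g $ 2 $ 2 - 1 = (det g - 1) - (g $ 1 $ 1 - 1) * (g $ 2 $ 2 * g $ 3 $ 3) - (g $ 3 $ 3 - 1) * g $ 2 $ 2
     + g $ 3 $ 2 * (g $ 1 $ 1 * g $ 2 $ 3) + g $ 2 $ 1 * (g $ 1 $ 2 * g $ 3 $ 3) - g $ 3 $ 1 * (g $ 1 $ 2 * g $ 2 $ 3)
     - g $ 2 $ 1 * (g $ 1 $ 3 * g $ 3 $ 2) + g $ 3 $ 1 * (g $ 1 $ 3 * g $ 2 $ 2)"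
    by (simp add: det_3 algebra_simps)
  moreover have "c \<le> \<omega> \<dots>" by (intro I det col 32 33)
  ultimately have 22: "c \<le> \<omega> (g $ 2 $ 2 - 1)" by (simp only:)
  have "g $ 1 $ 2 + \<sigma> (g $ 2 $ 3) = \<sigma> (?E 2 3) - g $ 3 $ 2 * \<sigma> (g $ 1 $ 3) - (g $ 2 $ 2 - 1) * \<sigma> (g $ 2 $ 3)
     - \<sigma> (g $ 3 $ 3 - 1) * g $ 1 $ 2"
    by (simp add: adj_mult_nth conj_simps algebra_simps)
  moreover have "c \<le> \<omega> \<dots>"
    by (rule d) (use E[of 2 3] 32 22 33 in \<open>simp_all add: nth_simps unit_mult_le int\<close>)
  ultimately have 12: "c \<le> \<omega> (g $ 1 $ 2 + \<sigma> (g $ 2 $ 3))" by (simp only:)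
  have "g $ 1 $ 3 + \<sigma> (g $ 1 $ 3) + g $ 2 $ 3 * \<sigma> (g $ 2 $ 3) =
     ?E 1 3 - \<sigma> (g $ 3 $ 3 - 1) * g $ 1 $ 3 - (g $ 3 $ 3 - 1) * \<sigma> (g $ 1 $ 3)"
    by (simp add: adj_mult_nth conj_simps algebra_simps)
  moreover have "c \<le> \<omega> \<dots>"
    by (rule val_diff[OF val_diff]) (use E[of 1 3] 33 in \<open>simp_all add: nth_simps unit_mult_le int\<close>)
  ultimately show "c \<le> \<omega> (g $ 1 $ 3 + \<sigma> (g $ 1 $ 3) + g $ 2 $ 3 * \<sigma> (g $ 2 $ 3))" by simp
  have neg: "\<omega> (x - y) = \<omega> (y - x)" for x y using val_uminus[of "x - y"] by simp
  have "\<omega> (- \<sigma> (g $ 2 $ 3) - g $ 1 $ 2) = \<omega> (g $ 1 $ 2 + \<sigma> (g $ 2 $ 3))"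
    using val_uminus[of "g $ 1 $ 2 + \<sigma> (g $ 2 $ 3)"] by (simp add: minus_diff_commute)
  then show "cong_mat c (upper_unip (g $ 2 $ 3) (g $ 1 $ 3)) g"
    unfolding cong_mat_def forall_3 using 12 22 32 33 col
    by (simp add: nth_simps neg[of 1])
qed

text \<open>Lifting the first column to \<open>p\<close> reduces to \<open>adj p ** g\<close>, which
  is congruent to an upper unipotent matrix. Correcting its corner entry with
  \<open>trace_solve\<close> makes that matrix unitary, so no limit process occurs.\<close>

lemma P0_lift:
  assumes c: "0 \<le> c" and int: "\<And>i j. 0 \<le> \<omega> (g $ i $ j)"
    and det: "c \<le> \<omega> (det g - 1)" and uni: "cong_mat c (adj g ** g) (mat 1)"
  shows "\<exists>p \<in> transporter 0 0. cong_mat c p g"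
proof (cases "c = 0")
  \<comment> \<open>Here the congruence is empty and the first column of \<open>g\<close> need not
    be primitive, so the identity is taken. This case occurs for \<open>r = 0\<close>.\<close>
  case True
  have "0 \<le> \<omega> ((mat 1 :: 'l mat33) $ i $ j - g $ i $ j)" for i j
    using transporter_one[of 0] by (intro val_diff int) (simp add: P0_nth)
  then show ?thesis using transporter_one[of 0] by (auto simp: cong_mat_def True)
next
  case False
  with c have c: "0 < c" by simp
  let ?x1 = "g $ 1 $ 1" and ?x2 = "g $ 2 $ 1" and ?x3 = "g $ 3 $ 1"
  have "c \<le> \<omega> ((adj g ** g) $ 3 $ 1 - (mat 1 :: 'l mat33) $ 3 $ 1)" using uni unfolding cong_mat_def by blast
  then have iso: "c \<le> \<omega> (\<sigma> ?x1 * ?x3 + \<sigma> ?x2 * ?x2 + \<sigma> ?x3 * ?x1)"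
    by (simp add: adj_mult_nth algebra_simps nth_simps)
  \<comment> \<open>If both outer entries lay in the maximal ideal, isotropy would force
    \<open>?x2\<close> into it, and then the determinant, which is congruent to 1.\<close>
  have unit: "\<omega> ?x1 = 0 \<or> \<omega> ?x3 = 0"
  proof (rule ccontr)
    assume "\<not> ?thesis"
    then have p: "0 < \<omega> ?x1" "0 < \<omega> ?x3" using int[of 1 1] int[of 3 1] by (auto simp: less_le)
    have pos: "0 < \<omega> (x * y)" if "0 < \<omega> x" "0 \<le> \<omega> y" for x y
      using that by (cases "\<omega> x"; cases "\<omega> y") (auto simp: val_mult)
    have "\<sigma> ?x2 * ?x2 = (\<sigma> ?x1 * ?x3 + \<sigma> ?x2 * ?x2 + \<sigma> ?x3 * ?x1) + (- (?x3 * \<sigma> ?x1)) + (- (?x1 * \<sigma> ?x3))"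
      by (simp add: algebra_simps)
    moreover have "0 < \<omega> \<dots>"
    proof (rule val_add_less[OF val_add_less])
      show "0 < \<omega> (\<sigma> ?x1 * ?x3 + \<sigma> ?x2 * ?x2 + \<sigma> ?x3 * ?x1)" using c iso by (rule less_le_trans)
    qed (simp_all add: pos p int)
    ultimately have "0 < \<omega> (\<sigma> ?x2 * ?x2)" by simp
    then have p2: "0 < \<omega> ?x2" by (cases "\<omega> ?x2") (auto simp: val_mult)
    have "1 = - (det g - 1) + ?x1 * (g $ 2 $ 2 * g $ 3 $ 3) + (- (?x1 * (g $ 2 $ 3 * g $ 3 $ 2)))
      + (- (?x2 * (g $ 1 $ 2 * g $ 3 $ 3))) + ?x2 * (g $ 1 $ 3 * g $ 3 $ 2)
      + ?x3 * (g $ 1 $ 2 * g $ 2 $ 3) + (- (?x3 * (g $ 1 $ 3 * g $ 2 $ 2)))"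
      by (simp add: det_3 algebra_simps)
    moreover have "0 < \<omega> \<dots>"
    proof (intro val_add_less)
      show "0 < \<omega> (- (det g - 1))" unfolding val_uminus using c det by (rule less_le_trans)
    qed (simp_all add: pos p p2 unit_mult_le int)
    ultimately have "0 < \<omega> 1" by (simp only:)
    then show False by simp
  qed
  obtain p where p: "p \<in> transporter 0 0"
    and pc: "c \<le> \<omega> (p $ 1 $ 1 - ?x1)" "c \<le> \<omega> (p $ 2 $ 1 - ?x2)" "c \<le> \<omega> (p $ 3 $ 1 - ?x3)"
    using column_lift[OF less_imp_le[OF c] int int int unit iso] by blast
  have pS: "p \<in> SU3 \<sigma>" using p transporter_SU3 by blast
  have p_int: "0 \<le> \<omega> (p $ i $ j)" "0 \<le> \<omega> (adj p $ i $ j)" for i j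
    using p transporter_adj[OF p] by (auto simp: P0_nth)
  define h where "h = adj p ** g"
  have ph: "p ** h = g" unfolding h_def using SU3_adj_right[OF pS] by (metis matrix_mul_assoc matrix_mul_lid)
  have h_int: "0 \<le> \<omega> (h $ i $ j)" for i j
    unfolding h_def mult_nth by (intro val_add unit_mult_le p_int int)
  have "det p = 1" "det (adj p) = 1" using pS SU3_adj[OF pS] by (auto simp: SU3_iff)
  then have h_det: "c \<le> \<omega> (det h - 1)" using det by (simp add: h_def det_mul)
  have "adj h ** h = adj g ** g"
    unfolding h_def adj_mult adj_adj using SU3_adj_right[OF pS] by (metis matrix_mul_assoc matrix_mul_lid)
  then have h_uni: "cong_mat c (adj h ** h) (mat 1)" using uni by simp
  have "c \<le> \<omega> (h $ i $ 1 - mat 1 $ i $ 1)" for i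
  proof -
    have "h $ i $ 1 - mat 1 $ i $ 1 = (adj p ** g) $ i $ 1 - (adj p ** p) $ i $ 1"
      using SU3_adj_left[OF pS] by (simp add: h_def)
    also have "\<dots> = - ((p $ 1 $ 1 - ?x1) * adj p $ i $ 1 + (p $ 2 $ 1 - ?x2) * adj p $ i $ 2
         + (p $ 3 $ 1 - ?x3) * adj p $ i $ 3)"
      by (simp add: mult_nth algebra_simps)
    finally have eq: "h $ i $ 1 - mat 1 $ i $ 1 = \<dots>" .
    show ?thesis unfolding eq val_uminus by (intro val_add unit_mult_le pc p_int)
  qed
  then have h_col: "c \<le> \<omega> (h $ 1 $ 1 - 1)" "c \<le> \<omega> (h $ 2 $ 1)" "c \<le> \<omega> (h $ 3 $ 1)"
    by (metis mat1_nth(1), metis mat1_nth(4) diff_zero, metis mat1_nth(7) diff_zero)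
  note up = cong_upper[OF h_int h_det h_uni h_col]
  obtain b where b: "c \<le> \<omega> (b - h $ 1 $ 3)" "b + \<sigma> b + h $ 2 $ 3 * \<sigma> (h $ 2 $ 3) = 0"
    using trace_solve[OF less_imp_le[OF c] up(1)] by blast
  have "0 \<le> \<omega> (b - h $ 1 $ 3)" using b(1) c by (meson less_imp_le order_trans)
  then have "0 \<le> \<omega> b" using val_add[of 0 "b - h $ 1 $ 3" "h $ 1 $ 3"] h_int by simp
  then have u: "upper_unip (h $ 2 $ 3) b \<in> transporter 0 0" using upper_unip_transporter[OF b(2), of 0] by (simp add: zero_ereal_def)
  have "cong_mat c (upper_unip (h $ 2 $ 3) b) h"
    using up(2) b(1) unfolding cong_mat_def forall_3 by (simp add: nth_simps)
  then have "cong_mat c (p ** upper_unip (h $ 2 $ 3) b) g"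
    using cong_mat_mult[OF p_int(1)] ph by metis
  then show ?thesis using transporter_mult[OF p u] by blast
qed

section \<open>Residue rings\<close>

text \<open>Divisibility by \<pi> is the form in which discreteness of the valuation is used from
  here on.\<close>

lemma val_pi_pos: "0 < \<omega> \<pi>" and pi_div: "0 < \<omega> x \<Longrightarrow> 0 \<le> \<omega> (x / \<pi>)"
proof -
  have *: "{a * \<pi> | a. 0 \<le> \<omega> a} = {x. 0 < \<omega> x}"
    using unif by (simp add: uniformiser_def cgenideal_def val_ring_def max_ideal_def)
  have "1 * \<pi> \<in> {a * \<pi> | a. 0 \<le> \<omega> a}" by (intro CollectI exI[of _ 1]) simp
  then show "0 < \<omega> \<pi>" unfolding * by simp
  show "0 \<le> \<omega> (x / \<pi>)" if "0 < \<omega> x"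
    using that * pi_nz by (smt (verit, best) mem_Collect_eq nonzero_mult_div_cancel_right)
qed

lemma v_pi: "0 < v \<pi>" using val_pi_pos val_eq_v[OF pi_nz] by simp

lemma segment_iff: "x \<in> segment \<omega> \<pi> r \<longleftrightarrow> \<bar>x\<bar> \<le> r * v \<pi>"
  using v_power[OF pi_nz, of r] by (auto simp: segment_def v_def)

lemma zero_in_segment: "0 \<in> segment \<omega> \<pi> r"
  using v_pi by (simp add: segment_iff)

definition level :: "nat \<Rightarrow> ereal" where "level r = ereal (r * v \<pi>)"

lemma level_nonneg: "0 \<le> level r" using v_pi by (simp add: level_def zero_ereal_def)

lemma cring_val_ring: "cring (val_ring \<omega>)"
proof (rule cringI)
  show "abelian_group (val_ring \<omega>)"
  proof (rule abelian_groupI)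
    fix x assume "x \<in> carrier (val_ring \<omega>)"
    then show "\<exists>y\<in>carrier (val_ring \<omega>). y \<oplus>\<^bsub>val_ring \<omega>\<^esub> x = \<zero>\<^bsub>val_ring \<omega>\<^esub>"
      by (intro bexI[of _ "- x"]) (auto simp: val_ring_def)
  qed (auto simp: val_ring_def val_add)
  show "Group.comm_monoid (val_ring \<omega>)"
    by (rule comm_monoidI) (auto simp: val_ring_def val_mult add_nonneg_nonneg)
qed (auto simp: val_ring_def algebra_simps)

lemma a_inv_val_ring: "0 \<le> \<omega> x \<Longrightarrow> \<ominus>\<^bsub>val_ring \<omega>\<^esub> x = - x"
proof -
  interpret cring "val_ring \<omega>" by (rule cring_val_ring)
  assume "0 \<le> \<omega> x"
  then show ?thesis using minus_equality[of "- x" x] by (simp add: val_ring_def)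
qed

text \<open>Every element of the maximal ideal is an integral multiple of \<pi>, so multiplying by
  this ideal raises the bound by exactly \<open>v \<pi>\<close>.\<close>

lemma max_ideal_pow_eq: "max_ideal_pow \<omega> r = {x. level r \<le> \<omega> x}"
proof (induction r)
  case 0
  then show ?case by (simp add: max_ideal_pow_def ideals_set_def nat_pow_def val_ring_def level_def zero_ereal_def)
next
  case (Suc r)
  have "max_ideal_pow \<omega> (Suc r) = ideal_prod (val_ring \<omega>) (max_ideal_pow \<omega> r) (max_ideal \<omega>)"
    by (simp add: max_ideal_pow_def ideals_set_def nat_pow_def)
  also have "\<dots> = ideal_prod (val_ring \<omega>) {x. level r \<le> \<omega> x} {x. 0 < \<omega> x}" (is "_ = ?I")
    by (simp add: Suc max_ideal_def)
  also have "\<dots> = {x. level (Suc r) \<le> \<omega> x}"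
  proof (intro equalityI subsetI)
    fix x assume "x \<in> ?I"
    then show "x \<in> {x. level (Suc r) \<le> \<omega> x}"
    proof (induction rule: ideal_prod.induct)
      case (prod i j)
      then have j: "0 \<le> \<omega> (j / \<pi>)" "level r \<le> \<omega> i" using pi_div by auto
      define k where "k = i * (j / \<pi>)"
      have "\<omega> (i * j) = \<omega> (k * \<pi>)" using pi_nz by (simp add: k_def)
      also have "\<dots> = \<omega> k + ereal (v \<pi>)" using val_mult val_eq_v[OF pi_nz] by simp
      finally have "\<omega> (i * j) = \<omega> k + ereal (v \<pi>)" .
      moreover have "level r + ereal (v \<pi>) \<le> \<omega> k + ereal (v \<pi>)"
        using unit_mult_le[OF j(2,1)] unfolding k_def by (rule add_right_mono)
      ultimately show ?case by (simp add: val_ring_def level_def algebra_simps)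
    next
      case (sum s1 s2)
      then show ?case by (simp add: val_ring_def val_add)
    qed
  next
    fix x assume x: "x \<in> {x. level (Suc r) \<le> \<omega> x}"
    have "level r \<le> \<omega> (x / \<pi>)"
    proof (cases "x = 0")
      case False
      then show ?thesis using x pi_nz by (simp add: val_eq_v v_divide level_def algebra_simps)
    qed simp
    then have "(x / \<pi>) \<otimes>\<^bsub>val_ring \<omega>\<^esub> \<pi> \<in> ?I" using val_pi_pos by (intro ideal_prod.prod) auto
    then show "x \<in> ?I" using pi_nz by (simp add: val_ring_def)
  qed
  finally show ?case .
qed

lemma ideal_max_ideal_pow: "ideal (max_ideal_pow \<omega> r) (val_ring \<omega>)"
proof -
  interpret cring "val_ring \<omega>" by (rule cring_val_ring)
  have sub: "0 \<le> \<omega> x" if "level r \<le> \<omega> x" for x using that level_nonneg order_trans by blast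
  show ?thesis
  proof (rule idealI)
    show "ring (val_ring \<omega>)" by (rule ring_axioms)
    show "subgroup (max_ideal_pow \<omega> r) (add_monoid (val_ring \<omega>))"
    proof (rule group.subgroupI)
      show "group (add_monoid (val_ring \<omega>))" by (rule a_group)
      show "max_ideal_pow \<omega> r \<noteq> {}" unfolding max_ideal_pow_eq using val_zero by (metis (full_types) mem_Collect_eq empty_iff ereal_less_eq(1))
      fix a assume a: "a \<in> max_ideal_pow \<omega> r"
      then have "inv\<^bsub>add_monoid (val_ring \<omega>)\<^esub> a = - a"
        using a_inv_val_ring[of a] sub by (simp add: max_ideal_pow_eq a_inv_def)
      then show "inv\<^bsub>add_monoid (val_ring \<omega>)\<^esub> a \<in> max_ideal_pow \<omega> r"
        using a by (simp add: max_ideal_pow_eq)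
    qed (auto simp: max_ideal_pow_eq val_ring_def sub val_add)
    fix a x assume "a \<in> max_ideal_pow \<omega> r" "x \<in> carrier (val_ring \<omega>)"
    then show "x \<otimes>\<^bsub>val_ring \<omega>\<^esub> a \<in> max_ideal_pow \<omega> r" "a \<otimes>\<^bsub>val_ring \<omega>\<^esub> x \<in> max_ideal_pow \<omega> r"
      using unit_mult_le[of "level r" a x] by (auto simp: max_ideal_pow_eq val_ring_def mult.commute)
  qed
qed

definition residue :: "nat \<Rightarrow> 'l \<Rightarrow> 'l set" where
  "residue r a = max_ideal_pow \<omega> r +>\<^bsub>val_ring \<omega>\<^esub> a"

lemma residue_eq: "residue r a = {x. level r \<le> \<omega> (x - a)}"
proof -
  have "x \<in> residue r a \<longleftrightarrow> (\<exists>i. level r \<le> \<omega> i \<and> x = i + a)" for x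
    by (auto simp: residue_def a_r_coset_def' max_ideal_pow_eq val_ring_def)
  moreover have "(\<exists>i. level r \<le> \<omega> i \<and> x = i + a) \<longleftrightarrow> level r \<le> \<omega> (x - a)" for x
    by (metis add_diff_cancel_right' diff_add_cancel)
  ultimately show ?thesis by auto
qed

lemma residue_eq_iff: "residue r a = residue r b \<longleftrightarrow> level r \<le> \<omega> (a - b)"
proof
  assume "residue r a = residue r b"
  moreover have "a \<in> residue r a" by (simp add: residue_eq)
  ultimately show "level r \<le> \<omega> (a - b)" by (simp add: residue_eq)
next
  assume *: "level r \<le> \<omega> (a - b)"
  have "level r \<le> \<omega> (x - a) \<longleftrightarrow> level r \<le> \<omega> (x - b)" for x
    using val_add[OF _ *, of "x - a"] val_diff[OF _ *, of "x - b"] by auto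
  then show "residue r a = residue r b" by (simp add: residue_eq)
qed

lemma residue_hom: "ring_hom_cring (val_ring \<omega>) (res_ring \<omega> r) (residue r)"
  unfolding res_ring_def residue_def
  using ideal.rcos_ring_hom_cring[OF ideal_max_ideal_pow cring_val_ring] .

lemma carrier_res_ring: "carrier (res_ring \<omega> r) = residue r ` {x. 0 \<le> \<omega> x}"
  by (auto simp: res_ring_def FactRing_def A_RCOSETS_def' residue_def val_ring_def)

lemma zero_res_ring: "\<zero>\<^bsub>res_ring \<omega> r\<^esub> = residue r 0"
  by (simp add: res_ring_def FactRing_def max_ideal_pow_eq residue_eq)

lemma one_res_ring: "\<one>\<^bsub>res_ring \<omega> r\<^esub> = residue r 1"
  by (simp add: res_ring_def FactRing_def residue_def val_ring_def)

lemma residue_mult: "0 \<le> \<omega> a \<Longrightarrow> 0 \<le> \<omega> b \<Longrightarrow> residue r a \<otimes>\<^bsub>res_ring \<omega> r\<^esub> residue r b = residue r (a * b)"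
proof -
  interpret h: ring_hom_cring "val_ring \<omega>" "res_ring \<omega> r" "residue r" by (rule residue_hom)
  assume "0 \<le> \<omega> a" "0 \<le> \<omega> b"
  then show ?thesis using h.hom_mult by (simp add: val_ring_def)
qed

lemma residue_uminus: "0 \<le> \<omega> a \<Longrightarrow> \<ominus>\<^bsub>res_ring \<omega> r\<^esub> residue r a = residue r (- a)"
proof -
  interpret h: ring_hom_cring "val_ring \<omega>" "res_ring \<omega> r" "residue r" by (rule residue_hom)
  assume "0 \<le> \<omega> a"
  then have "a \<in> carrier (val_ring \<omega>)" by (simp add: val_ring_def)
  from h.hom_a_inv[OF this] show ?thesis using \<open>0 \<le> \<omega> a\<close> by (simp add: a_inv_val_ring)
qed

lemma val_prod: "(\<And>k. k \<in> K \<Longrightarrow> 0 \<le> \<omega> (f k)) \<Longrightarrow> 0 \<le> \<omega> (prod f K)"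
  by (induction K rule: infinite_finite_induct) (auto intro: unit_mult_le)

text \<open>Sums over the residue ring are taken on integral representatives with the operations of
  the field; this carries matrix products and determinants over to reductions.\<close>

lemma finsum_residue:
  assumes "finite K" "\<And>k. k \<in> K \<Longrightarrow> 0 \<le> \<omega> (f k)"
  shows "(\<Oplus>\<^bsub>res_ring \<omega> r\<^esub>k\<in>K. residue r (f k)) = residue r (sum f K)"
proof -
  interpret h: ring_hom_cring "val_ring \<omega>" "res_ring \<omega> r" "residue r" by (rule residue_hom)
  have "finsum (val_ring \<omega>) f K = sum f K" using assms
  proof (induction K rule: finite_induct)
    case (insert k K)
    then have "f \<in> K \<rightarrow> carrier (val_ring \<omega>)" "f k \<in> carrier (val_ring \<omega>)" by (auto simp: val_ring_def)
    then have "finsum (val_ring \<omega>) f (insert k K) = f k \<oplus>\<^bsub>val_ring \<omega>\<^esub> finsum (val_ring \<omega>) f K"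
      using insert(1,2) by (simp add: h.R.finsum_insert)
    then show ?case using insert by (simp add: val_ring_def)
  qed (simp add: val_ring_def[THEN arg_cong[where f = zero]])
  moreover have "f \<in> K \<rightarrow> carrier (val_ring \<omega>)" using assms by (auto simp: val_ring_def)
  ultimately show ?thesis using h.hom_finsum[of f K] by (simp add: comp_def)
qed

lemma finprod_residue:
  assumes "finite K" "\<And>k. k \<in> K \<Longrightarrow> 0 \<le> \<omega> (f k)"
  shows "(\<Otimes>\<^bsub>res_ring \<omega> r\<^esub>k\<in>K. residue r (f k)) = residue r (prod f K)"
proof -
  interpret h: ring_hom_cring "val_ring \<omega>" "res_ring \<omega> r" "residue r" by (rule residue_hom)
  have "finprod (val_ring \<omega>) f K = prod f K" using assms
  proof (induction K rule: finite_induct)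
    case (insert k K)
    then have "f \<in> K \<rightarrow> carrier (val_ring \<omega>)" "f k \<in> carrier (val_ring \<omega>)" by (auto simp: val_ring_def)
    then have "finprod (val_ring \<omega>) f (insert k K) = f k \<otimes>\<^bsub>val_ring \<omega>\<^esub> finprod (val_ring \<omega>) f K"
      using insert(1,2) by (simp add: h.R.finprod_insert)
    then show ?case using insert by (simp add: val_ring_def)
  qed (simp add: val_ring_def[THEN arg_cong[where f = one]])
  moreover have "f \<in> K \<rightarrow> carrier (val_ring \<omega>)" using assms by (auto simp: val_ring_def)
  ultimately show ?thesis using h.hom_finprod[of f K] by (simp add: comp_def)
qed

text \<open>The choice in \<open>res_val\<close> is harmless: in a nonzero coset two representatives
  differ by an element of larger valuation. The valuation is thus truncated at
  \<open>level r\<close>.\<close>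

lemma res_val_residue: "res_val \<omega> r (residue r a) = (if level r \<le> \<omega> a then \<infinity> else \<omega> a)"
proof (cases "level r \<le> \<omega> a")
  case True
  then show ?thesis by (simp add: res_val_def zero_res_ring residue_eq_iff)
next
  case False
  have "a \<in> residue r a" by (simp add: residue_eq)
  then have "(SOME b. b \<in> residue r a) \<in> residue r a" by (rule someI)
  then have "\<omega> (SOME b. b \<in> residue r a) = \<omega> a"
    using False by (intro val_eq_of_diff) (auto simp: residue_eq)
  then show ?thesis using False by (simp add: res_val_def zero_res_ring residue_eq_iff)
qed

lemma res_conj_residue: "res_conj \<sigma> (residue r a) = residue r (\<sigma> a)"
proof -
  have "x \<in> \<sigma> ` residue r a \<longleftrightarrow> \<sigma> x \<in> residue r a" for x by (metis conj_conj image_iff)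
  moreover have "\<omega> (\<sigma> x - a) = \<omega> (x - \<sigma> a)" for x
    using val_conj[of "\<sigma> x - a"] by (simp add: conj_diff)
  ultimately show ?thesis by (auto simp: res_conj_def residue_eq)
qed

section \<open>Matrices over the residue ring\<close>

definition integral_mat :: "'l mat33 \<Rightarrow> bool" where "integral_mat g \<longleftrightarrow> (\<forall>i j. 0 \<le> \<omega> (g $ i $ j))"

lemma integral_mat_mult: "integral_mat g \<Longrightarrow> integral_mat h \<Longrightarrow> integral_mat (g ** h)"
  unfolding integral_mat_def mult_nth by (auto intro!: val_add unit_mult_le)

lemma integral_mat_adj: "integral_mat g \<Longrightarrow> integral_mat (adj g)"
  by (simp add: integral_mat_def adj_nth)

lemma P0_iff: "g \<in> transporter 0 0 \<longleftrightarrow> g \<in> SU3 \<sigma> \<and> integral_mat g"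
  by (simp add: P0_nth integral_mat_def)

lemma reduce_nth: "reduce \<omega> r g $ i $ j = residue r (g $ i $ j)"
  by (simp add: reduce_def map_mat_def residue_def)

lemma reduce_eq_iff: "reduce \<omega> r g = reduce \<omega> r h \<longleftrightarrow> cong_mat (level r) g h"
  by (simp add: vec_eq_iff reduce_nth residue_eq_iff cong_mat_def)

lemma carrier_mat_monoid: "carrier (mat_monoid (res_ring \<omega> r)) = reduce \<omega> r ` {g. integral_mat g}"
proof (intro equalityI subsetI)
  fix X assume "X \<in> carrier (mat_monoid (res_ring \<omega> r))"
  then have "\<forall>i j. \<exists>a. 0 \<le> \<omega> a \<and> X $ i $ j = residue r a"
    by (simp add: mat_monoid_def carrier_res_ring image_iff Bex_def)
  then obtain f where f: "\<And>i j. 0 \<le> \<omega> (f i j) \<and> X $ i $ j = residue r (f i j)" by metis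
  then have "X = reduce \<omega> r (\<chi> i j. f i j)" by (simp add: vec_eq_iff reduce_nth)
  moreover have "integral_mat (\<chi> i j. f i j)" using f by (simp add: integral_mat_def)
  ultimately show "X \<in> reduce \<omega> r ` {g. integral_mat g}" by blast
qed (auto simp: mat_monoid_def carrier_res_ring reduce_nth integral_mat_def)

lemma reduce_mult:
  assumes "integral_mat g" "integral_mat h"
  shows "reduce \<omega> r g \<otimes>\<^bsub>mat_monoid (res_ring \<omega> r)\<^esub> reduce \<omega> r h = reduce \<omega> r (g ** h)"
proof -
  have *: "0 \<le> \<omega> (g $ i $ k)" "0 \<le> \<omega> (h $ i $ k)" for i k using assms by (auto simp: integral_mat_def)
  have "(\<Oplus>\<^bsub>res_ring \<omega> r\<^esub>k\<in>UNIV. residue r (g $ i $ k) \<otimes>\<^bsub>res_ring \<omega> r\<^esub> residue r (h $ k $ j)) = residue r ((g ** h) $ i $ j)" for i j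
    unfolding residue_mult[OF *] by (subst finsum_residue) (auto simp: matrix_matrix_mult_def intro: unit_mult_le *)
  then show ?thesis by (simp add: mat_monoid_def vec_eq_iff reduce_nth)
qed

lemma reduce_one: "\<one>\<^bsub>mat_monoid (res_ring \<omega> r)\<^esub> = reduce \<omega> r (mat 1)"
  by (simp add: mat_monoid_def vec_eq_iff reduce_nth one_res_ring zero_res_ring mat_def)

lemma reduce_adj: "antitranspose (map_mat (res_conj \<sigma>) (reduce \<omega> r g)) = reduce \<omega> r (adj g)"
  by (simp add: vec_eq_iff antitranspose_def map_mat_def reduce_nth res_conj_residue adj_nth)

lemma mat_det_reduce:
  assumes "integral_mat g"
  shows "mat_det (res_ring \<omega> r) (reduce \<omega> r g) = residue r (det g)"
proof -
  have *: "0 \<le> \<omega> (g $ i $ k)" for i k using assms by (auto simp: integral_mat_def)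
  have prod: "0 \<le> \<omega> (\<Prod>i\<in>UNIV. g $ i $ p i)" for p :: "3 \<Rightarrow> 3" by (intro val_prod *)
  have sgn: "(if evenperm p then \<one>\<^bsub>res_ring \<omega> r\<^esub> else \<ominus>\<^bsub>res_ring \<omega> r\<^esub> \<one>\<^bsub>res_ring \<omega> r\<^esub>) = residue r (of_int (sign p))" for p :: "3 \<Rightarrow> 3"
    by (simp add: sign_def one_res_ring residue_uminus)
  have sgn0: "0 \<le> \<omega> (of_int (sign p))" for p :: "3 \<Rightarrow> 3" by (simp add: sign_def)
  have fin: "finite {p. p permutes (UNIV :: 3 set)}" by (rule finite_permutations) simp
  show ?thesis
    unfolding mat_det_def sgn reduce_nth det_def
    by (simp add: finprod_residue * residue_mult sgn0 prod finsum_residue[OF fin] unit_mult_le)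
qed

text \<open>For an arbitrary integral matrix, because a representative chosen entrywise is unitary
  only up to a congruence and still has to be lifted.\<close>

lemma reduce_in_loc_P:
  assumes "integral_mat g"
  shows "reduce \<omega> r g \<in> loc_P \<omega> \<sigma> r x \<longleftrightarrow> level r \<le> \<omega> (det g - 1) \<and> cong_mat (level r) (adj g ** g) (mat 1) \<and>
    (\<forall>i j. ereal (wt x i - wt x j) \<le> res_val \<omega> r (residue r (g $ i $ j)))"
proof -
  have "reduce \<omega> r g \<in> carrier (mat_monoid (res_ring \<omega> r))" using assms by (auto simp: carrier_mat_monoid)
  then show ?thesis using assms
    by (simp add: loc_P_def Let_def SL3_def mat_det_reduce one_res_ring residue_eq_iff reduce_adj reduce_mult
        integral_mat_adj reduce_one reduce_eq_iff mat_val_ge_def V_mat_eq reduce_nth)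
qed

text \<open>The largest difference of weights is \<bar>x\<bar>, attained at a corner. This ties the
  length of the segment to the power of the maximal ideal.\<close>

lemma wt_diff_le:
  assumes "x \<in> segment \<omega> \<pi> r" shows "ereal (wt x i - wt x j) \<le> level r"
proof -
  have "\<forall>i j. wt x i - wt x j \<le> r * v \<pi>" unfolding forall_3 wt_def
    using assms by (auto simp: segment_iff abs_le_iff)
  then show ?thesis by (simp add: level_def)
qed

lemma SU3_cong: "g \<in> SU3 \<sigma> \<Longrightarrow> level r \<le> \<omega> (det g - 1) \<and> cong_mat (level r) (adj g ** g) (mat 1)"
  by (simp add: SU3_iff cong_mat_def)

text \<open>A bound not exceeding \<open>level r\<close> is not affected by truncation at
  \<open>level r\<close>.\<close>

lemma reduce_in_loc_P_iff:
  assumes g: "g \<in> transporter 0 0" and x: "x \<in> segment \<omega> \<pi> r"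
  shows "reduce \<omega> r g \<in> loc_P \<omega> \<sigma> r x \<longleftrightarrow> g \<in> transporter x x"
proof -
  have "ereal (wt x i - wt x j) \<le> res_val \<omega> r (residue r a) \<longleftrightarrow> ereal (wt x i - wt x j) \<le> \<omega> a" for i j a
    using wt_diff_le[OF x, of i j] order_trans[of _ "level r" "\<omega> a"] by (auto simp: res_val_residue)
  moreover have "integral_mat g" "g \<in> SU3 \<sigma>" using g by (simp_all add: P0_iff)
  ultimately show ?thesis using SU3_cong[of g r] by (simp add: reduce_in_loc_P transporter_def)
qed

text \<open>This contains the surjectivity of the reduction map, for which \<open>P0_lift\<close>
  was made.\<close>

lemma loc_P_zero: "loc_P \<omega> \<sigma> r 0 = reduce \<omega> r ` transporter 0 0"
proof (intro equalityI subsetI)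
  fix X assume X: "X \<in> loc_P \<omega> \<sigma> r 0"
  then have "X \<in> carrier (mat_monoid (res_ring \<omega> r))" by (simp add: loc_P_def Let_def SL3_def)
  then obtain g where g: "X = reduce \<omega> r g" "integral_mat g" by (auto simp: carrier_mat_monoid)
  then have "level r \<le> \<omega> (det g - 1)" "cong_mat (level r) (adj g ** g) (mat 1)"
    using X reduce_in_loc_P by auto
  then obtain p where "p \<in> transporter 0 0" "cong_mat (level r) p g"
    using P0_lift[OF level_nonneg, of g r] g(2) unfolding integral_mat_def by blast
  then show "X \<in> reduce \<omega> r ` transporter 0 0" using g(1) reduce_eq_iff by (metis imageI)
next
  fix X assume "X \<in> reduce \<omega> r ` transporter 0 0"
  then show "X \<in> loc_P \<omega> \<sigma> r 0" using reduce_in_loc_P_iff[OF _ zero_in_segment] by auto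
qed

lemma m_inv_reduce:
  assumes g: "g \<in> transporter 0 0"
  shows "m_inv (mat_monoid (res_ring \<omega> r)) (reduce \<omega> r g) = reduce \<omega> r (adj g)"
proof -
  have i: "integral_mat g" "integral_mat (adj g)" and inv: "g ** adj g = mat 1" "adj g ** g = mat 1"
    using g P0_iff integral_mat_adj SU3_adj_left SU3_adj_right by auto
  show ?thesis unfolding m_inv_def
  proof (rule the_equality)
    show "reduce \<omega> r (adj g) \<in> carrier (mat_monoid (res_ring \<omega> r)) \<and>
      reduce \<omega> r g \<otimes>\<^bsub>mat_monoid (res_ring \<omega> r)\<^esub> reduce \<omega> r (adj g) = \<one>\<^bsub>mat_monoid (res_ring \<omega> r)\<^esub> \<and>
      reduce \<omega> r (adj g) \<otimes>\<^bsub>mat_monoid (res_ring \<omega> r)\<^esub> reduce \<omega> r g = \<one>\<^bsub>mat_monoid (res_ring \<omega> r)\<^esub>"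
      using i inv by (auto simp: carrier_mat_monoid reduce_mult reduce_one)
  next
    fix Y assume *: "Y \<in> carrier (mat_monoid (res_ring \<omega> r)) \<and>
      reduce \<omega> r g \<otimes>\<^bsub>mat_monoid (res_ring \<omega> r)\<^esub> Y = \<one>\<^bsub>mat_monoid (res_ring \<omega> r)\<^esub> \<and>
      Y \<otimes>\<^bsub>mat_monoid (res_ring \<omega> r)\<^esub> reduce \<omega> r g = \<one>\<^bsub>mat_monoid (res_ring \<omega> r)\<^esub>"
    then obtain y where y: "Y = reduce \<omega> r y" "integral_mat y" by (auto simp: carrier_mat_monoid)
    then have "cong_mat (level r) (g ** y) (mat 1)"
      using * i by (simp add: reduce_mult reduce_one reduce_eq_iff)
    then have "cong_mat (level r) (adj g ** (g ** y)) (adj g ** mat 1)"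
      using i by (intro cong_mat_mult) (auto simp: integral_mat_def)
    then show "Y = reduce \<omega> r (adj g)"
      using y inv by (simp add: reduce_eq_iff matrix_mul_assoc)
  qed
qed

section \<open>The local relation for positive \<open>r\<close>\<close>

context
  fixes r :: nat assumes r: "0 < r"
begin

lemma level_pos: "0 < level r" using r v_pi by (simp add: level_def)

lemma res_val_residue_eq_zero: "res_val \<omega> r (residue r a) = 0 \<longleftrightarrow> \<omega> a = 0"
  using level_pos by (auto simp: res_val_residue)

lemma unit_inverse: "\<omega> z = 0 \<Longrightarrow> z \<noteq> 0 \<and> \<omega> (inverse z) = 0"
proof -
  assume "\<omega> z = 0"
  moreover from this have "z \<noteq> 0" by auto
  ultimately show ?thesis by (simp add: val_eq_v v_inverse zero_ereal_def)
qed

lemma m_inv_residue: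
  assumes "\<omega> z = 0" shows "m_inv (res_ring \<omega> r) (residue r z) = residue r (inverse z)"
proof -
  have "residue r z \<in> carrier (res_ring \<omega> r)" "residue r (inverse z) \<in> carrier (res_ring \<omega> r)"
    "residue r z \<otimes>\<^bsub>res_ring \<omega> r\<^esub> residue r (inverse z) = \<one>\<^bsub>res_ring \<omega> r\<^esub>"
    using unit_inverse[OF assms] assms by (auto simp: carrier_res_ring residue_mult one_res_ring)
  note inv = this
  interpret h: ring_hom_cring "val_ring \<omega>" "res_ring \<omega> r" "residue r" by (rule residue_hom)
  show ?thesis using inv by (rule h.S.comm_inv_char)
qed

lemma reduce_diag3: "reduce \<omega> r (diag3 0 a b c) = diag3 \<zero>\<^bsub>res_ring \<omega> r\<^esub> (residue r a) (residue r b) (residue r c)"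
  by (simp add: vec_eq_iff reduce_nth diag3_def zero_res_ring)

lemma reduce_antidiag3: "reduce \<omega> r (antidiag3 0 a b c) = antidiag3 \<zero>\<^bsub>res_ring \<omega> r\<^esub> (residue r a) (residue r b) (residue r c)"
  by (simp add: vec_eq_iff reduce_nth antidiag3_def zero_res_ring)

lemma units_P0: assumes "\<omega> z = 0" shows "torus_elt z \<in> transporter 0 0" "weyl_elt z \<in> transporter 0 0"
  using torus_elt_transporter[of z 0] weyl_elt_transporter[of z 0] unit_inverse[OF assms] assms by (simp_all add: v_def)

lemma reduce_SL3: "g \<in> transporter 0 0 \<Longrightarrow> reduce \<omega> r g \<in> SL3 (res_ring \<omega> r)"
  using loc_P_zero[of r] by (fastforce simp: loc_P_def Let_def)

lemma reduce_torus_elt: assumes "\<omega> z = 0"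
  shows "reduce \<omega> r (torus_elt z) = diag3 \<zero>\<^bsub>res_ring \<omega> r\<^esub> (residue r z)
    (m_inv (res_ring \<omega> r) (residue r z) \<otimes>\<^bsub>res_ring \<omega> r\<^esub> res_conj \<sigma> (residue r z)) (m_inv (res_ring \<omega> r) (res_conj \<sigma> (residue r z)))"
  using assms unit_inverse[OF assms]
  by (simp add: torus_elt_def reduce_diag3 m_inv_residue res_conj_residue residue_mult)

lemma reduce_weyl_elt: assumes "\<omega> z = 0"
  shows "reduce \<omega> r (weyl_elt z) = antidiag3 \<zero>\<^bsub>res_ring \<omega> r\<^esub> (residue r z)
    (\<ominus>\<^bsub>res_ring \<omega> r\<^esub> (m_inv (res_ring \<omega> r) (residue r z) \<otimes>\<^bsub>res_ring \<omega> r\<^esub> res_conj \<sigma> (residue r z)))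
    (m_inv (res_ring \<omega> r) (res_conj \<sigma> (residue r z)))"
  using assms unit_inverse[OF assms]
  by (simp add: weyl_elt_def reduce_antidiag3 m_inv_residue res_conj_residue residue_mult residue_uminus unit_mult_le)

text \<open>For positive \<open>r\<close> valuation zero is visible after reduction, so a parameter
  of valuation zero has only units as representatives, and inverses may be taken before
  reducing.\<close>

lemma loc_H_eq: "loc_H \<omega> \<sigma> r = {reduce \<omega> r (torus_elt z) | z. \<omega> z = 0}"
proof (intro equalityI subsetI)
  fix X assume "X \<in> loc_H \<omega> \<sigma> r"
  then obtain z where z: "0 \<le> \<omega> z" "res_val \<omega> r (residue r z) = 0" and
    X: "X = diag3 \<zero>\<^bsub>res_ring \<omega> r\<^esub> (residue r z)
      (m_inv (res_ring \<omega> r) (residue r z) \<otimes>\<^bsub>res_ring \<omega> r\<^esub> res_conj \<sigma> (residue r z))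
      (m_inv (res_ring \<omega> r) (res_conj \<sigma> (residue r z)))"
    unfolding loc_H_def Let_def carrier_res_ring by blast
  have "\<omega> z = 0" using z(2) unfolding res_val_residue_eq_zero .
  then show "X \<in> {reduce \<omega> r (torus_elt z) | z. \<omega> z = 0}" unfolding X using reduce_torus_elt[of z, symmetric] by blast
next
  fix X assume "X \<in> {reduce \<omega> r (torus_elt z) | z. \<omega> z = 0}"
  then obtain z where z: "X = reduce \<omega> r (torus_elt z)" "\<omega> z = 0" by blast
  have "X \<in> SL3 (res_ring \<omega> r)" unfolding z(1) by (rule reduce_SL3[OF units_P0(1)[OF z(2)]])
  moreover have "residue r z \<in> carrier (res_ring \<omega> r)" using z(2) by (simp add: carrier_res_ring)
  moreover have "res_val \<omega> r (residue r z) = 0" using z(2) res_val_residue_eq_zero by blast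
  ultimately show "X \<in> loc_H \<omega> \<sigma> r"
    unfolding loc_H_def Let_def using reduce_torus_elt[OF z(2)] z(1) by blast
qed

lemma loc_M_eq: "loc_M \<omega> \<sigma> r = {reduce \<omega> r (weyl_elt z) | z. \<omega> z = 0}"
proof (intro equalityI subsetI)
  fix X assume "X \<in> loc_M \<omega> \<sigma> r"
  then obtain z where z: "0 \<le> \<omega> z" "res_val \<omega> r (residue r z) = 0" and
    X: "X = antidiag3 \<zero>\<^bsub>res_ring \<omega> r\<^esub> (residue r z)
      (\<ominus>\<^bsub>res_ring \<omega> r\<^esub> (m_inv (res_ring \<omega> r) (residue r z) \<otimes>\<^bsub>res_ring \<omega> r\<^esub> res_conj \<sigma> (residue r z)))
      (m_inv (res_ring \<omega> r) (res_conj \<sigma> (residue r z)))"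
    unfolding loc_M_def Let_def carrier_res_ring by blast
  have "\<omega> z = 0" using z(2) unfolding res_val_residue_eq_zero .
  then show "X \<in> {reduce \<omega> r (weyl_elt z) | z. \<omega> z = 0}" unfolding X using reduce_weyl_elt[of z, symmetric] by blast
next
  fix X assume "X \<in> {reduce \<omega> r (weyl_elt z) | z. \<omega> z = 0}"
  then obtain z where z: "X = reduce \<omega> r (weyl_elt z)" "\<omega> z = 0" by blast
  have "X \<in> SL3 (res_ring \<omega> r)" unfolding z(1) by (rule reduce_SL3[OF units_P0(2)[OF z(2)]])
  moreover have "residue r z \<in> carrier (res_ring \<omega> r)" using z(2) by (simp add: carrier_res_ring)
  moreover have "res_val \<omega> r (residue r z) = 0" using z(2) res_val_residue_eq_zero by blast
  ultimately show "X \<in> loc_M \<omega> \<sigma> r"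
    unfolding loc_M_def Let_def using reduce_weyl_elt[OF z(2)] z(1) by blast
qed

lemma loc_nu_torus_elt: "\<omega> z = 0 \<Longrightarrow> loc_\<nu> \<omega> \<sigma> r (reduce \<omega> r (torus_elt z)) x = x"
  by (auto simp: loc_\<nu>_def loc_H_eq)

lemma loc_nu_weyl_elt: assumes "\<omega> z = 0" shows "loc_\<nu> \<omega> \<sigma> r (reduce \<omega> r (weyl_elt z)) x = - x"
proof -
  have "reduce \<omega> r (weyl_elt z) \<noteq> reduce \<omega> r (torus_elt w)" if "\<omega> w = 0" for w
  proof
    assume "reduce \<omega> r (weyl_elt z) = reduce \<omega> r (torus_elt w)"
    \<comment> \<open>The entries at (1,1) are 0 and a unit, which positive \<open>r\<close> keeps
      distinct.\<close>
    then have "level r \<le> \<omega> (weyl_elt z $ 1 $ 1 - torus_elt w $ 1 $ 1)" unfolding reduce_eq_iff cong_mat_def by blast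
    then show False using that level_pos by (simp add: nth_simps)
  qed
  then show ?thesis by (auto simp: loc_\<nu>_def loc_H_eq)
qed

text \<open>A monomial element with unit parameter fixes the origin and carries \<open>x\<close> to
  \<open>x\<close> or \<open>- x\<close>. Hence it can be cancelled as in \<open>bt_rel_iff\<close>,
  after everything has been lifted; the parameter 1 shows that both signs occur.\<close>

lemma loc_rel_reduce:
  assumes g: "g \<in> transporter 0 0" and h: "h \<in> transporter 0 0" and x: "x \<in> segment \<omega> \<pi> r" and y: "y \<in> segment \<omega> \<pi> r"
  shows "((reduce \<omega> r g, x), (reduce \<omega> r h, y)) \<in> loc_rel \<omega> \<sigma> \<pi> r \<longleftrightarrow> \<bar>x\<bar> = \<bar>y\<bar> \<and> adj g ** h \<in> transporter x y"
proof -
  let ?M = "mat_monoid (res_ring \<omega> r)"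
  let ?k = "adj g ** h"
  have gh: "?k \<in> transporter 0 0" using transporter_mult[OF transporter_adj[OF g] h] .
  have key: "m_inv ?M (reduce \<omega> r g) \<otimes>\<^bsub>?M\<^esub> reduce \<omega> r h \<otimes>\<^bsub>?M\<^esub> reduce \<omega> r n \<in> loc_P \<omega> \<sigma> r x
     \<longleftrightarrow> ?k \<in> transporter x y" if n: "n \<in> transporter 0 0" "n \<in> transporter y x" for n
  proof -
    have "m_inv ?M (reduce \<omega> r g) \<otimes>\<^bsub>?M\<^esub> reduce \<omega> r h \<otimes>\<^bsub>?M\<^esub> reduce \<omega> r n = reduce \<omega> r (?k ** n)"
      using g h n(1) gh by (simp add: m_inv_reduce reduce_mult P0_iff integral_mat_adj integral_mat_mult)
    moreover have "reduce \<omega> r (?k ** n) \<in> loc_P \<omega> \<sigma> r x \<longleftrightarrow> ?k ** n \<in> transporter x x"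
      using transporter_mult[OF gh n(1)] x by (rule reduce_in_loc_P_iff)
    moreover have "?k ** n \<in> transporter x x \<longleftrightarrow> ?k \<in> transporter x y"
    proof
      assume "?k ** n \<in> transporter x x"
      then have "?k ** n ** adj n \<in> transporter x y" using transporter_adj transporter_mult n(2) by blast
      then show "?k \<in> transporter x y"
        using SU3_adj_right[OF transporter_SU3[OF n(1)]] by (metis matrix_mul_assoc matrix_mul_rid)
    qed (use transporter_mult n(2) in blast)
    ultimately show ?thesis by simp
  qed
  have u: "torus_elt z \<in> transporter x x" "weyl_elt z \<in> transporter (- x) x" if "\<omega> z = 0" for z
    using torus_elt_transporter[of z x] weyl_elt_transporter[of z x] unit_inverse[OF that] that by (simp_all add: v_def)
  let ?Q = "\<lambda>n. loc_\<nu> \<omega> \<sigma> r n x = y \<and> m_inv ?M (reduce \<omega> r g) \<otimes>\<^bsub>?M\<^esub> reduce \<omega> r h \<otimes>\<^bsub>?M\<^esub> n \<in> loc_P \<omega> \<sigma> r x"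
  have Qt: "?Q (reduce \<omega> r (torus_elt z)) \<longleftrightarrow> x = y \<and> ?k \<in> transporter x y" if "\<omega> z = 0" for z
    using key[of "torus_elt z"] u[OF that] units_P0[OF that] loc_nu_torus_elt[OF that] by auto
  have Qm: "?Q (reduce \<omega> r (weyl_elt z)) \<longleftrightarrow> - x = y \<and> ?k \<in> transporter x y" if "\<omega> z = 0" for z
    using key[of "weyl_elt z"] u[OF that] units_P0[OF that] loc_nu_weyl_elt[OF that] by auto
  have "(\<exists>n \<in> loc_N \<omega> \<sigma> r. ?Q n) \<longleftrightarrow> (\<exists>z. \<omega> z = 0 \<and> ?Q (reduce \<omega> r (torus_elt z))) \<or> (\<exists>z. \<omega> z = 0 \<and> ?Q (reduce \<omega> r (weyl_elt z)))"
    unfolding loc_N_def loc_H_eq loc_M_eq by blast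
  also have "\<dots> \<longleftrightarrow> (x = y \<or> - x = y) \<and> ?k \<in> transporter x y"
    using Qt Qm val_one by metis
  also have "x = y \<or> - x = y \<longleftrightarrow> \<bar>x\<bar> = \<bar>y\<bar>" by auto
  finally show ?thesis using g h x y by (simp add: loc_rel_def Let_def loc_P_zero)
qed

end

text \<open>
  For \<open>r = 0\<close> the residue ring is zero, and \<open>\<omega> 0 = \<infinity>\<close> leaves \<open>N\<^sup>0\<^sup>,\<^sup>r\<close> empty; the local tree then has
  the empty set as its only point.
\<close>
lemma loc_rel_0: "loc_rel \<omega> \<sigma> \<pi> 0 = {}"
proof -
  have "level 0 = 0" by (simp add: level_def zero_ereal_def)
  then have "res_val \<omega> 0 X = 0 \<Longrightarrow> X \<notin> carrier (res_ring \<omega> 0)" for X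
    by (auto simp: carrier_res_ring res_val_residue)
  then have "loc_N \<omega> \<sigma> 0 = {}" by (auto simp: loc_N_def loc_H_def loc_M_def Let_def)
  then show ?thesis by (simp add: loc_rel_def Let_def)
qed

section \<open>Comparison of the two trees\<close>

lemma bt_tree_eq: "bt_tree \<omega> \<sigma> = {bt_class \<omega> \<sigma> g x | g x. g \<in> SU3 \<sigma>}"
  by (auto simp: bt_tree_def bt_class_def quotient_def)

lemma bt_class_P0: "g \<in> transporter 0 0 \<Longrightarrow> bt_class \<omega> \<sigma> (mat 1) 0 = bt_class \<omega> \<sigma> g 0"
  by (simp add: bt_class_eq_iff SU3_one transporter_SU3 same_orbit_refl)

text \<open>Since \<open>g\<close> fixes the origin, both points lie in the apartment of
  \<open>g\<close>, where the metric is known.\<close>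

lemma dist_origin:
  assumes d: "bt_metric \<omega> \<sigma> \<pi> d" and g: "g \<in> transporter 0 0"
  shows "d (bt_class \<omega> \<sigma> (mat 1) 0) (bt_class \<omega> \<sigma> g x) = \<bar>x\<bar> / v \<pi>"
  using d transporter_SU3[OF g] unfolding bt_class_P0[OF g] bt_metric_def v_def by simp

text \<open>The relation \<open>same_orbit\<close> also admits translations and other reflections;
  the distance from the origin excludes those that change \<bar>x\<bar>. Conversely, both signs lie
  in one orbit.\<close>

lemma bt_class_eq_P0_iff:
  assumes d: "bt_metric \<omega> \<sigma> \<pi> d" and g: "g \<in> transporter 0 0" and h: "h \<in> transporter 0 0"
  shows "bt_class \<omega> \<sigma> g x = bt_class \<omega> \<sigma> h y \<longleftrightarrow> \<bar>x\<bar> = \<bar>y\<bar> \<and> adj g ** h \<in> transporter x y"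
proof -
  have iff: "bt_class \<omega> \<sigma> g x = bt_class \<omega> \<sigma> h y \<longleftrightarrow> same_orbit x y \<and> adj g ** h \<in> transporter x y"
    using bt_class_eq_iff transporter_SU3 g h by blast
  have "\<bar>x\<bar> = \<bar>y\<bar>" if "bt_class \<omega> \<sigma> g x = bt_class \<omega> \<sigma> h y"
    using dist_origin[OF d g, of x] dist_origin[OF d h, of y] v_pi that by simp
  moreover have "same_orbit x y" if "\<bar>x\<bar> = \<bar>y\<bar>"
    using that same_orbit_refl[of x] same_orbit_minus[of x] by (auto simp: abs_eq_iff)
  ultimately show ?thesis using iff by blast
qed

lemma bt_ball_eq:
  assumes d: "bt_metric \<omega> \<sigma> \<pi> d"
  shows "bt_ball \<omega> \<sigma> d r = {bt_class \<omega> \<sigma> g x | g x. g \<in> transporter 0 0 \<and> x \<in> segment \<omega> \<pi> r}"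
proof -
  interpret Metric_space "bt_tree \<omega> \<sigma>" d using d by (simp add: bt_metric_def)
  have o: "bt_class \<omega> \<sigma> (mat 1) 0 \<in> bt_tree \<omega> \<sigma>" using SU3_one by (auto simp: bt_tree_eq)
  have mem: "bt_class \<omega> \<sigma> g x \<in> bt_ball \<omega> \<sigma> d r \<longleftrightarrow> x \<in> segment \<omega> \<pi> r" if "g \<in> transporter 0 0" for g x
  proof -
    have "bt_class \<omega> \<sigma> g x \<in> bt_tree \<omega> \<sigma>" using transporter_SU3[OF that] by (auto simp: bt_tree_eq)
    then show ?thesis using o v_pi
      by (simp add: bt_ball_def in_mcball dist_origin[OF d that] segment_iff field_simps)
  qed
  have "\<exists>g x. g \<in> transporter 0 0 \<and> p = bt_class \<omega> \<sigma> g x" if "p \<in> bt_ball \<omega> \<sigma> d r" for p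
  proof -
    have "p \<in> bt_tree \<omega> \<sigma>" using that by (simp add: bt_ball_def in_mcball)
    then show ?thesis using bt_class_representative by (auto simp: bt_tree_eq)
  qed
  then show ?thesis using mem by blast
qed

text \<open>Describes a local class entirely by equality of points in the tree, so that equality of
  local classes and the action on them are inherited from there.\<close>

lemma loc_class_reduce:
  assumes d: "bt_metric \<omega> \<sigma> \<pi> d" and r: "0 < r" and g: "g \<in> transporter 0 0" and x: "x \<in> segment \<omega> \<pi> r"
  shows "loc_class \<omega> \<sigma> \<pi> r (reduce \<omega> r g) x =
    {(reduce \<omega> r k, w) | k w. k \<in> transporter 0 0 \<and> w \<in> segment \<omega> \<pi> r \<and> bt_class \<omega> \<sigma> g x = bt_class \<omega> \<sigma> k w}"
proof -
  have iff: "((reduce \<omega> r g, x), (reduce \<omega> r k, w)) \<in> loc_rel \<omega> \<sigma> \<pi> r \<longleftrightarrow> bt_class \<omega> \<sigma> g x = bt_class \<omega> \<sigma> k w"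
    if "k \<in> transporter 0 0" "w \<in> segment \<omega> \<pi> r" for k w
    unfolding loc_rel_reduce[OF r g that(1) x that(2)] bt_class_eq_P0_iff[OF d g that(1)] ..
  have sub: "loc_rel \<omega> \<sigma> \<pi> r \<subseteq> UNIV \<times> (reduce \<omega> r ` transporter 0 0 \<times> segment \<omega> \<pi> r)"
    by (auto simp: loc_rel_def Let_def loc_P_zero)
  show ?thesis unfolding loc_class_def
  proof (intro equalityI subsetI)
    fix P assume P: "P \<in> loc_rel \<omega> \<sigma> \<pi> r `` {(reduce \<omega> r g, x)}"
    then obtain k w where k: "k \<in> transporter 0 0" "w \<in> segment \<omega> \<pi> r" and eq: "P = (reduce \<omega> r k, w)"
      using sub by blast
    then show "P \<in> {(reduce \<omega> r k, w) | k w. k \<in> transporter 0 0 \<and> w \<in> segment \<omega> \<pi> r \<and> bt_class \<omega> \<sigma> g x = bt_class \<omega> \<sigma> k w}"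
      using P iff[OF k] by blast
  next
    fix P assume "P \<in> {(reduce \<omega> r k, w) | k w. k \<in> transporter 0 0 \<and> w \<in> segment \<omega> \<pi> r \<and> bt_class \<omega> \<sigma> g x = bt_class \<omega> \<sigma> k w}"
    then show "P \<in> loc_rel \<omega> \<sigma> \<pi> r `` {(reduce \<omega> r g, x)}" using iff by blast
  qed
qed

lemma loc_class_0: "loc_class \<omega> \<sigma> \<pi> 0 X x = {}"
  by (simp add: loc_class_def loc_rel_0)

lemma loc_class_eq_iff:
  assumes d: "bt_metric \<omega> \<sigma> \<pi> d" and g: "g \<in> transporter 0 0" and h: "h \<in> transporter 0 0"
    and x: "x \<in> segment \<omega> \<pi> r" and y: "y \<in> segment \<omega> \<pi> r"
  shows "loc_class \<omega> \<sigma> \<pi> r (reduce \<omega> r g) x = loc_class \<omega> \<sigma> \<pi> r (reduce \<omega> r h) y \<longleftrightarrow>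
    bt_class \<omega> \<sigma> g x = bt_class \<omega> \<sigma> h y"
proof (cases "r = 0")
  case True
  \<comment> \<open>The segment is a point and every \<open>g\<close> fixing the origin gives that
    origin, so both sides of the equivalence hold.\<close>
  then have "x = 0" "y = 0" using x y by (auto simp: segment_iff)
  moreover have "adj g ** h \<in> transporter 0 0" using g h transporter_adj transporter_mult by blast
  ultimately show ?thesis using True bt_class_eq_P0_iff[OF d g h] by (simp add: loc_class_0)
next
  case False
  then have r: "0 < r" by simp
  show ?thesis
  proof
    assume "loc_class \<omega> \<sigma> \<pi> r (reduce \<omega> r g) x = loc_class \<omega> \<sigma> \<pi> r (reduce \<omega> r h) y"
    moreover have "(reduce \<omega> r h, y) \<in> loc_class \<omega> \<sigma> \<pi> r (reduce \<omega> r h) y"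
      unfolding loc_class_reduce[OF d r h y] using h y by blast
    ultimately have "(reduce \<omega> r h, y) \<in> loc_class \<omega> \<sigma> \<pi> r (reduce \<omega> r g) x" by (simp only:)
    then have "((reduce \<omega> r g, x), (reduce \<omega> r h, y)) \<in> loc_rel \<omega> \<sigma> \<pi> r"
      unfolding loc_class_def Image_singleton_iff .
    then show "bt_class \<omega> \<sigma> g x = bt_class \<omega> \<sigma> h y"
      using loc_rel_reduce[OF r g h x y] bt_class_eq_P0_iff[OF d g h] by blast
  next
    assume "bt_class \<omega> \<sigma> g x = bt_class \<omega> \<sigma> h y"
    then show "loc_class \<omega> \<sigma> \<pi> r (reduce \<omega> r g) x = loc_class \<omega> \<sigma> \<pi> r (reduce \<omega> r h) y"
      by (simp add: loc_class_reduce[OF d r g x] loc_class_reduce[OF d r h y])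
  qed
qed

lemma loc_act_class:
  assumes d: "bt_metric \<omega> \<sigma> \<pi> d" and h: "h \<in> transporter 0 0" and g: "g \<in> transporter 0 0" and x: "x \<in> segment \<omega> \<pi> r"
  shows "loc_act \<omega> r (reduce \<omega> r h) (loc_class \<omega> \<sigma> \<pi> r (reduce \<omega> r g) x) = loc_class \<omega> \<sigma> \<pi> r (reduce \<omega> r (h ** g)) x"
proof (cases "r = 0")
  case False
  then have r: "0 < r" by simp
  have act: "bt_class \<omega> \<sigma> (h ** k) w = bt_act h (bt_class \<omega> \<sigma> k w)" if "k \<in> transporter 0 0" for k w
    using bt_act_class h that transporter_SU3 by metis
  have hS: "h ** adj h = mat 1" using h transporter_SU3 SU3_adj_right by blast
  have inj: "bt_class \<omega> \<sigma> g x = bt_class \<omega> \<sigma> k w" if "bt_class \<omega> \<sigma> (h ** g) x = bt_class \<omega> \<sigma> (h ** k) w" "k \<in> transporter 0 0" for k w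
  proof -
    have eq: "adj (h ** g) ** (h ** k) = adj g ** k"
      using SU3_adj_left[OF transporter_SU3[OF h]] by (metis adj_mult matrix_mul_assoc matrix_mul_lid)
    show ?thesis
      using that(1) unfolding bt_class_eq_P0_iff[OF d transporter_mult[OF h g] transporter_mult[OF h that(2)]] eq
        bt_class_eq_P0_iff[OF d g that(2)] .
  qed
  let ?M = "mat_monoid (res_ring \<omega> r)"
  have m: "reduce \<omega> r h \<otimes>\<^bsub>?M\<^esub> reduce \<omega> r k = reduce \<omega> r (h ** k)" if "k \<in> transporter 0 0" for k
    using h that by (simp add: reduce_mult P0_iff)
  show ?thesis
    unfolding loc_class_reduce[OF d r g x] loc_class_reduce[OF d r transporter_mult[OF h g] x] loc_act_def
  proof (intro equalityI subsetI)
    fix P assume "P \<in> (\<lambda>(g, x). (reduce \<omega> r h \<otimes>\<^bsub>?M\<^esub> g, x)) ` {(reduce \<omega> r k, w) | k w. k \<in> transporter 0 0 \<and>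
       w \<in> segment \<omega> \<pi> r \<and> bt_class \<omega> \<sigma> g x = bt_class \<omega> \<sigma> k w}"
    then obtain k w where k: "k \<in> transporter 0 0" "w \<in> segment \<omega> \<pi> r" "bt_class \<omega> \<sigma> g x = bt_class \<omega> \<sigma> k w"
      and P: "P = (reduce \<omega> r h \<otimes>\<^bsub>?M\<^esub> reduce \<omega> r k, w)" by auto
    have "P = (reduce \<omega> r (h ** k), w)" using P m k(1) by simp
    moreover have "h ** k \<in> transporter 0 0" using transporter_mult h k(1) by blast
    moreover have "bt_class \<omega> \<sigma> (h ** g) x = bt_class \<omega> \<sigma> (h ** k) w" using k act g by simp
    ultimately show "P \<in> {(reduce \<omega> r k, w) | k w. k \<in> transporter 0 0 \<and>
       w \<in> segment \<omega> \<pi> r \<and> bt_class \<omega> \<sigma> (h ** g) x = bt_class \<omega> \<sigma> k w}" using k(2) by blast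
  next
    fix P assume "P \<in> {(reduce \<omega> r k, w) | k w. k \<in> transporter 0 0 \<and>
       w \<in> segment \<omega> \<pi> r \<and> bt_class \<omega> \<sigma> (h ** g) x = bt_class \<omega> \<sigma> k w}"
    then obtain k w where k: "k \<in> transporter 0 0" "w \<in> segment \<omega> \<pi> r" "bt_class \<omega> \<sigma> (h ** g) x = bt_class \<omega> \<sigma> k w"
      and P: "P = (reduce \<omega> r k, w)" by auto
    \<comment> \<open>The preimage under \<open>h\<close> of the representative \<open>k\<close>; it
      makes the action surjective onto the class.\<close>
    define k' where "k' = adj h ** k"
    have k': "k' \<in> transporter 0 0" "h ** k' = k"
      using transporter_mult[OF transporter_adj[OF h] k(1)] hS by (simp_all add: k'_def matrix_mul_assoc)
    then have "bt_class \<omega> \<sigma> g x = bt_class \<omega> \<sigma> k' w" using inj k(3) by blast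
    then have "(reduce \<omega> r k', w) \<in> {(reduce \<omega> r k, w) | k w. k \<in> transporter 0 0 \<and>
       w \<in> segment \<omega> \<pi> r \<and> bt_class \<omega> \<sigma> g x = bt_class \<omega> \<sigma> k w}" using k' k(2) by blast
    moreover have "P = (\<lambda>(g, x). (reduce \<omega> r h \<otimes>\<^bsub>?M\<^esub> g, x)) (reduce \<omega> r k', w)" using P m k' by simp
    ultimately show "P \<in> (\<lambda>(g, x). (reduce \<omega> r h \<otimes>\<^bsub>?M\<^esub> g, x)) ` {(reduce \<omega> r k, w) | k w. k \<in> transporter 0 0 \<and>
       w \<in> segment \<omega> \<pi> r \<and> bt_class \<omega> \<sigma> g x = bt_class \<omega> \<sigma> k w}" by blast
  qed
qed (simp add: loc_class_0 loc_act_def)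

lemma loc_tree_eq:
  "loc_tree \<omega> \<sigma> \<pi> r = {loc_class \<omega> \<sigma> \<pi> r (reduce \<omega> r g) x | g x. g \<in> transporter 0 0 \<and> x \<in> segment \<omega> \<pi> r}"
  unfolding loc_tree_def quotient_def loc_class_def loc_P_zero by auto

theorem ball_local_bijection:
  assumes d: "bt_metric \<omega> \<sigma> \<pi> d"
  shows "\<exists>f. (\<forall>g \<in> transporter 0 0. \<forall>x \<in> segment \<omega> \<pi> r.
            f (bt_class \<omega> \<sigma> g x) = loc_class \<omega> \<sigma> \<pi> r (reduce \<omega> r g) x) \<and>
         bij_betw f (bt_ball \<omega> \<sigma> d r) (loc_tree \<omega> \<sigma> \<pi> r) \<and>
         (\<forall>h \<in> transporter 0 0. \<forall>p \<in> bt_ball \<omega> \<sigma> d r.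
            f (bt_act h p) = loc_act \<omega> r (reduce \<omega> r h) (f p))"
proof -
  \<comment> \<open>By \<open>loc_class_eq_iff\<close> the family for a point of the ball has a
    single member, so its union is that class and no representative is chosen. This also covers
    \<open>r = 0\<close>, where the class is empty.\<close>
  define f where "f C = \<Union>{loc_class \<omega> \<sigma> \<pi> r (reduce \<omega> r g) x | g x.
      g \<in> transporter 0 0 \<and> x \<in> segment \<omega> \<pi> r \<and> C = bt_class \<omega> \<sigma> g x}" for C
  have f: "f (bt_class \<omega> \<sigma> g x) = loc_class \<omega> \<sigma> \<pi> r (reduce \<omega> r g) x"
    if "g \<in> transporter 0 0" "x \<in> segment \<omega> \<pi> r" for g x
  proof -
    have "{loc_class \<omega> \<sigma> \<pi> r (reduce \<omega> r h) y | h y.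
      h \<in> transporter 0 0 \<and> y \<in> segment \<omega> \<pi> r \<and> bt_class \<omega> \<sigma> g x = bt_class \<omega> \<sigma> h y} =
      {loc_class \<omega> \<sigma> \<pi> r (reduce \<omega> r g) x}"
      using that loc_class_eq_iff[OF d that(1) _ that(2)] by blast
    then show ?thesis by (simp add: f_def)
  qed
  have "bij_betw f (bt_ball \<omega> \<sigma> d r) (loc_tree \<omega> \<sigma> \<pi> r)"
    unfolding bij_betw_def
  proof
    show "inj_on f (bt_ball \<omega> \<sigma> d r)"
    proof (rule inj_onI)
      fix p q assume "p \<in> bt_ball \<omega> \<sigma> d r" "q \<in> bt_ball \<omega> \<sigma> d r" and eq: "f p = f q"
      then obtain g x h y where g: "g \<in> transporter 0 0" "x \<in> segment \<omega> \<pi> r" "p = bt_class \<omega> \<sigma> g x"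
        and h: "h \<in> transporter 0 0" "y \<in> segment \<omega> \<pi> r" "q = bt_class \<omega> \<sigma> h y"
        unfolding bt_ball_eq[OF d] by blast
      show "p = q" using eq unfolding g(3) h(3) f[OF g(1,2)] f[OF h(1,2)]
        using loc_class_eq_iff[OF d g(1) h(1) g(2) h(2)] by blast
    qed
    have "f ` bt_ball \<omega> \<sigma> d r = {f (bt_class \<omega> \<sigma> g x) | g x. g \<in> transporter 0 0 \<and> x \<in> segment \<omega> \<pi> r}"
      unfolding bt_ball_eq[OF d] by blast
    also have "\<dots> = loc_tree \<omega> \<sigma> \<pi> r" unfolding loc_tree_eq using f by metis
    finally show "f ` bt_ball \<omega> \<sigma> d r = loc_tree \<omega> \<sigma> \<pi> r" .
  qed
  moreover have "f (bt_act h p) = loc_act \<omega> r (reduce \<omega> r h) (f p)"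
    if h: "h \<in> transporter 0 0" and p: "p \<in> bt_ball \<omega> \<sigma> d r" for h p
  proof -
    obtain g x where g: "g \<in> transporter 0 0" "x \<in> segment \<omega> \<pi> r" "p = bt_class \<omega> \<sigma> g x"
      using p bt_ball_eq[OF d] by auto
    then have "bt_act h p = bt_class \<omega> \<sigma> (h ** g) x" using h bt_act_class transporter_SU3 by blast
    moreover have "h ** g \<in> transporter 0 0" using transporter_mult h g(1) by blast
    ultimately show ?thesis unfolding g(3) by (simp only: f g(1,2) loc_act_class[OF d h g(1,2)])
  qed
  ultimately show ?thesis by (intro exI[of _ f] conjI ballI f)
qed

end

theorem theorem5p19:
  fixes \<iota> :: "'k::field \<Rightarrow> 'l::field"
    and \<omega> :: "'l \<Rightarrow> ereal"
    and \<sigma> :: "'l \<Rightarrow> 'l"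
    and \<pi> :: 'l
    and d :: "('l mat33 \<times> real) set \<Rightarrow> ('l mat33 \<times> real) set \<Rightarrow> real"
    and r :: nat
  assumes "nonarch_local_field (\<omega> \<circ> \<iota>)"
    and "quadratic_ext \<iota>"
    and "valuation \<omega>"
    and "unramified \<iota> \<omega>"
    and "nontrivial_automorphism \<iota> \<sigma>"
    and "uniformiser \<omega> \<pi>"
    and "bt_metric \<omega> \<sigma> \<pi> d"
  shows "bt_ball \<omega> \<sigma> d r = {bt_class \<omega> \<sigma> g x | g x. g \<in> bt_P \<omega> \<sigma> 0 \<and> x \<in> segment \<omega> \<pi> r} \<and>
    (\<exists>f. (\<forall>g \<in> bt_P \<omega> \<sigma> 0. \<forall>x \<in> segment \<omega> \<pi> r.
            f (bt_class \<omega> \<sigma> g x) = loc_class \<omega> \<sigma> \<pi> r (reduce \<omega> r g) x) \<and>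
         bij_betw f (bt_ball \<omega> \<sigma> d r) (loc_tree \<omega> \<sigma> \<pi> r) \<and>
         (\<forall>h \<in> bt_P \<omega> \<sigma> 0. \<forall>p \<in> bt_ball \<omega> \<sigma> d r.
            f (bt_act h p) = loc_act \<omega> r (reduce \<omega> r h) (f p)))"
proof -
  interpret K: unramified_quadratic \<iota> \<sigma> \<omega>
    using assms by unfold_locales
  \<comment> \<open>If \<pi> were 0, the maximal ideal would be zero, but the uniformiser of
    \<open>K\<close> lies in it.\<close>
  have "\<pi> \<noteq> 0"
  proof
    assume "\<pi> = 0"
    then have *: "{a * 0 | a. 0 \<le> \<omega> a} = {x. 0 < \<omega> x}"
      using assms(6) by (simp add: uniformiser_def cgenideal_def val_ring_def max_ideal_def)
    obtain p where p: "p \<noteq> 0" "0 < K.v (\<iota> p)" using K.uniformiser_range by blast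
    then have "\<iota> p \<in> {x. 0 < \<omega> x}" using K.val_eq_v[of "\<iota> p"] by (simp add: K.emb_simps)
    then show False using p(1) unfolding *[symmetric] by (auto simp: K.emb_simps)
  qed
  then interpret unitary \<omega> \<sigma> \<pi>
    by unfold_locales (use assms(6) K.val_aut K.trace_one K.aut_aut in \<open>auto simp: K.aut_simps\<close>)
  show ?thesis
    unfolding bt_P_eq using bt_ball_eq[OF assms(7)] ball_local_bijection[OF assms(7)] by blast
qed

end
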